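(* Consider the eigenvalue problem $$-U_{xx}-8\,\delta_{1/2}U=\lambda U,\qquad U(0)=U(1)=0.$$ There is a negative eigenvalue $\lambda_1<0$, which is unique (it is the only negative eigenvalue); $0$ is not an eigenvalue; and there is an infinite, countable number of positive eigenvalues $0<\lambda_2\le\lambda_3\le\cdots$.
   Context: For $u\in H_0^1(0,1)$ (identified with its continuous representative), $\delta_{1/2}u\in H^{-1}(0,1)$ is defined by $\langle\delta_{1/2}u,\varphi\rangle_{(H^{-1},H_0^1)}=u(\tfrac12)\varphi(\tfrac12)$ for $\varphi\in H_0^1(0,1)$. A solution of the problem for $\lambda\in\mathbb R$ is $U\in H_0^1(0,1)$ satisfying the equation in $H^{-1}(0,1)$; $\lambda$ is an eigenvalue if a nonzero solution exists. *)

theory Defs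
  imports "HOL-Analysis.Analysis"
begin

text \<open>
  Real Sobolev spaces on the interval (0,1), following Brezis,
  ``Functional Analysis, Sobolev Spaces and Partial Differential Equations'', Chapter 8:
  test functions are of class C^1 with compact support, and H^1_0 is their closure in H^1.
  (Using smooth test functions gives the same spaces.)
  Functions are total functions on the reals of which only the values on the interval matter;
  the test functions are extended by zero.
\<close>

abbreviation unit_meas :: "real measure" where
  "unit_meas \<equiv> lebesgue_on {0<..<1}"

definition test_fun :: "(real \<Rightarrow> real) set" where
  "test_fun = {\<phi>. \<phi> C1_differentiable_on UNIV \<and>
     compact (closure {x. \<phi> x \<noteq> 0}) \<and> closure {x. \<phi> x \<noteq> 0} \<subseteq> {0<..<1}}"

definition L2_fun :: "(real \<Rightarrow> real) set" where
  "L2_fun = {f. f \<in> borel_measurable unit_meas \<and> integrable unit_meas (\<lambda>x. (f x)\<^sup>2)}"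

definition has_weak_deriv :: "(real \<Rightarrow> real) \<Rightarrow> (real \<Rightarrow> real) \<Rightarrow> bool" where
  "has_weak_deriv u g \<longleftrightarrow> u \<in> L2_fun \<and> g \<in> L2_fun \<and>
     (\<forall>\<phi>\<in>test_fun. (LINT x|unit_meas. u x * deriv \<phi> x) = - (LINT x|unit_meas. g x * \<phi> x))"

definition H1 :: "(real \<Rightarrow> real) set" where
  "H1 = {u. \<exists>g. has_weak_deriv u g}"

text \<open>The weak derivative is determined only up to null sets; it is used only under integrals.\<close>

definition weak_deriv :: "(real \<Rightarrow> real) \<Rightarrow> real \<Rightarrow> real" where
  "weak_deriv u = (SOME g. has_weak_deriv u g)"

definition H1_norm :: "(real \<Rightarrow> real) \<Rightarrow> real" where
  "H1_norm u = sqrt ((LINT x|unit_meas. (u x)\<^sup>2) + (LINT x|unit_meas. (weak_deriv u x)\<^sup>2))"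

text \<open>
  Elements of H^1_0 are given by their representative continuous on the closed interval, so
  that point values make sense; that these vanish at 0 and 1 is a consequence of the density
  of the test functions.
\<close>

definition H10 :: "(real \<Rightarrow> real) set" where
  "H10 = {u. u \<in> H1 \<and> continuous_on {0..1} u \<and>
     (\<exists>\<phi>. (\<forall>n::nat. \<phi> n \<in> test_fun) \<and>
          (\<lambda>n. H1_norm (\<lambda>x. \<phi> n x - u x)) \<longlonglongrightarrow> 0)}"

text \<open>
  Elements of the dual space H^{-1} are given by their action on H^1_0; two of them are equal
  if they agree there.
\<close>

definition delta_half :: "(real \<Rightarrow> real) \<Rightarrow> (real \<Rightarrow> real) \<Rightarrow> real" where
  "delta_half u \<phi> = u (1/2) * \<phi> (1/2)"

text \<open>The second derivative of \<open>u\<close>, as the distributional derivative of \<open>weak_deriv u\<close>.\<close>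

definition second_deriv :: "(real \<Rightarrow> real) \<Rightarrow> (real \<Rightarrow> real) \<Rightarrow> real" where
  "second_deriv u \<phi> = - (LINT x|unit_meas. weak_deriv u x * weak_deriv \<phi> x)"

definition L2_functional :: "(real \<Rightarrow> real) \<Rightarrow> (real \<Rightarrow> real) \<Rightarrow> real" where
  "L2_functional f \<phi> = (LINT x|unit_meas. f x * \<phi> x)"

definition is_solution :: "real \<Rightarrow> (real \<Rightarrow> real) \<Rightarrow> bool" where
  "is_solution lam U \<longleftrightarrow> U \<in> H10 \<and>
     (\<forall>\<phi>\<in>H10. - second_deriv U \<phi> - 8 * delta_half U \<phi> = lam * L2_functional U \<phi>)"

definition is_eigenvalue :: "real \<Rightarrow> bool" where
  "is_eigenvalue lam \<longleftrightarrow> (\<exists>U. is_solution lam U \<and> (\<exists>x\<in>{0..1}. U x \<noteq> 0))"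

end

theory Submission
  imports Defs "HOL-Real_Asymp.Real_Asymp" "HOL-Complex_Analysis.Complex_Analysis"
begin

text \<open>
  Every \<open>\<phi>\<close> in \<open>H10\<close> is the primitive of its weak derivative, so \<open>\<phi> (1/2)\<close> and the
  pairing of \<open>U\<close> with \<open>\<phi>\<close> are integrals against \<open>\<phi>'\<close>: with \<open>V\<close> the primitive of \<open>U\<close>, the
  equation says that \<open>U' - 8 U(1/2) 1\<^bsub>x \<le> 1/2\<^esub> + \<lambda> V\<close> is orthogonal to all \<open>\<phi>'\<close>, that is,
  constant almost everywhere. Hence \<open>U\<close> solves \<open>- U'' = \<lambda> U\<close> classically on both halves of the
  interval, with the jump \<open>U'(1/2-) - U'(1/2+) = 8 U(1/2)\<close>. If \<open>S\<close> and \<open>C = S'\<close> are the solutions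
  with \<open>S(0) = 0\<close> and \<open>C(0) = 1\<close>, then \<open>U\<close> is a multiple of \<open>S(x)\<close> on the left and of \<open>S(1 - x)\<close> on
  the right, and \<open>\<lambda>\<close> is an eigenvalue iff \<open>S(1/2) (C(1/2) - 4 S(1/2)) = 0\<close>. For \<open>\<lambda> = - (2 t)\<^sup>2\<close> this
  is \<open>t cosh t = 2 sinh t\<close>, which has exactly one positive root; for \<open>\<lambda> = (2 t)\<^sup>2\<close> it says that
  \<open>t\<close> is a zero of the entire function \<open>sin t (t cos t - 2 sin t)\<close>, and these are discrete.
\<close>

section \<open>Test functions\<close>

lemma finite_measure_unit: "finite_measure unit_meas"
  by (intro finite_measureI) (simp add: emeasure_restrict_space)

lemma measure_space_unit: "measure unit_meas (space unit_meas) = 1"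
  by (simp add: measure_restrict_space)

lemma LINT_const_unit: "(LINT x|unit_meas. (c::real)) = c"
  using measure_space_unit by simp

lemma AE_unitI: "(\<And>x. 0 < x \<Longrightarrow> x < 1 \<Longrightarrow> P x) \<Longrightarrow> AE x in unit_meas. P x"
  by (rule AE_I2) simp

lemma measurable_unit_continuous:
  fixes f :: "real \<Rightarrow> real"
  assumes "continuous_on {0..1} f"
  shows "f \<in> borel_measurable unit_meas"
  by (rule continuous_imp_measurable_on_sets_lebesgue[OF continuous_on_subset[OF assms]]) auto

lemma measurable_unit_borel:
  fixes f :: "real \<Rightarrow> real"
  assumes "f \<in> borel_measurable borel"
  shows "f \<in> borel_measurable unit_meas"
  using assms by (simp add: measurable_completion measurable_restrict_space1)

lemma integrable_unit_bounded:
  fixes f :: "real \<Rightarrow> real"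
  assumes "f \<in> borel_measurable unit_meas" "\<And>x. 0 < x \<Longrightarrow> x < 1 \<Longrightarrow> \<bar>f x\<bar> \<le> B"
  shows "integrable unit_meas f"
  by (rule finite_measure.integrable_const_bound[OF finite_measure_unit AE_unitI[of _ ] assms(1)])
     (use assms(2) in simp)

lemma integrable_unit_continuous:
  fixes f :: "real \<Rightarrow> real"
  assumes "continuous_on {0..1} f"
  shows "integrable unit_meas f"
proof -
  have "bounded (f ` {0..1})"
    using assms by (intro compact_imp_bounded compact_continuous_image) auto
  then obtain B where "\<And>x. x \<in> {0..1} \<Longrightarrow> norm (f x) \<le> B"
    unfolding bounded_iff by blast
  then show ?thesis
    using measurable_unit_continuous[OF assms] by (intro integrable_unit_bounded[where B = B]) auto
qed

lemma LINT_dominated_unit: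
  fixes f :: "real \<Rightarrow> real"
  assumes "\<And>n. s n \<in> borel_measurable unit_meas" "f \<in> borel_measurable unit_meas"
    and "integrable unit_meas w"
    and "\<And>n x. 0 < x \<Longrightarrow> x < 1 \<Longrightarrow> \<bar>s n x\<bar> \<le> w x"
    and "AE x in unit_meas. (\<lambda>n. s n x) \<longlonglongrightarrow> f x"
  shows "(\<lambda>n. LINT x|unit_meas. s n x) \<longlonglongrightarrow> (LINT x|unit_meas. f x)"
  by (rule integral_dominated_convergence[OF assms(2,1,3,5)]) (use assms(4) in \<open>auto intro: AE_unitI\<close>)

section \<open>Supports, derivatives and cut-offs of test functions\<close>

lemma test_funI:
  assumes "\<phi> C1_differentiable_on UNIV" "0 < a" "b < 1" "\<And>x. x \<notin> {a..b} \<Longrightarrow> \<phi> x = 0"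
  shows "\<phi> \<in> test_fun"
proof -
  have "{x. \<phi> x \<noteq> 0} \<subseteq> {a..b}"
    using assms(4) by blast
  then have "closure {x. \<phi> x \<noteq> 0} \<subseteq> {a..b}"
    by (simp add: closure_minimal)
  moreover have "{a..b} \<subseteq> {0<..<1}"
    using assms by auto
  moreover have "compact (closure {x. \<phi> x \<noteq> 0})"
    using \<open>closure {x. \<phi> x \<noteq> 0} \<subseteq> {a..b}\<close> compact_Icc[of a b]
    by (meson bounded_subset closed_closure compact_eq_bounded_closed)
  ultimately show ?thesis
    using assms(1) unfolding test_fun_def by blast
qed

lemma test_funE:
  assumes "\<phi> \<in> test_fun"
  obtains a b where "0 < a" "a < b" "b < 1" "\<forall>x. x \<notin> {a..b} \<longrightarrow> \<phi> x = 0"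
proof -
  \<comment> \<open>Adding the point 1/2 keeps the compact set nonempty when \<phi> is identically
    zero, so that its minimum and maximum exist.\<close>
  let ?K = "insert (1/2) (closure {x. \<phi> x \<noteq> 0})"
  have K: "compact ?K" "?K \<subseteq> {0<..<1}" "?K \<noteq> {}"
    using assms by (auto simp: test_fun_def)
  obtain a where a: "a \<in> ?K" "\<forall>x\<in>?K. a \<le> x"
    using compact_attains_inf[OF K(1,3)] by (elim bexE)
  obtain b where b: "b \<in> ?K" "\<forall>x\<in>?K. x \<le> b"
    using compact_attains_sup[OF K(1,3)] by (elim bexE)
  have "0 < a" "b < 1"
    using subsetD[OF K(2) a(1)] subsetD[OF K(2) b(1)] by simp_all
  \<comment> \<open>Equality occurs if the set is a single point; halving the left end below makes
    the inequality strict.\<close>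
  have "a \<le> b"
    using a(2) b(1) by (rule bspec)
  with \<open>0 < a\<close> \<open>b < 1\<close> have *: "0 < a / 2" "a / 2 < b" "b < 1"
    by simp_all
  have "{x. \<phi> x \<noteq> 0} \<subseteq> ?K"
    by (rule order_trans[OF closure_subset subset_insertI])
  also have "?K \<subseteq> {a/2..b}"
  proof
    fix x assume "x \<in> ?K"
    with a(2) b(2) have "a \<le> x" "x \<le> b" by (metis bspec)+
    then show "x \<in> {a/2..b}" using \<open>0 < a\<close> by simp
  qed
  finally have "\<forall>x. x \<notin> {a/2..b} \<longrightarrow> \<phi> x = 0"
    by (meson mem_Collect_eq subsetD)
  with * show thesis by (rule that)
qed

text \<open>The library notion asserts only that some continuous derivative exists; uniqueness of
  derivatives identifies it with \<open>deriv \<phi>\<close>, the form in which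
  \<open>has_weak_deriv\<close> uses it.\<close>

lemma C1_UNIV_iff:
  fixes \<phi> :: "real \<Rightarrow> real"
  shows "\<phi> C1_differentiable_on UNIV \<longleftrightarrow>
    (\<forall>x. (\<phi> has_real_derivative deriv \<phi> x) (at x)) \<and> continuous_on UNIV (deriv \<phi>)"
proof
  assume "\<phi> C1_differentiable_on UNIV"
  then obtain D where D: "\<And>x. (\<phi> has_real_derivative D x) (at x)" "continuous_on UNIV D"
    unfolding C1_differentiable_on_def by (auto simp: has_real_derivative_iff_has_vector_derivative)
  then have "deriv \<phi> = D"
    by (auto intro: DERIV_imp_deriv)
  with D show "(\<forall>x. (\<phi> has_real_derivative deriv \<phi> x) (at x)) \<and> continuous_on UNIV (deriv \<phi>)"
    by simp
next
  assume "(\<forall>x. (\<phi> has_real_derivative deriv \<phi> x) (at x)) \<and> continuous_on UNIV (deriv \<phi>)"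
  then show "\<phi> C1_differentiable_on UNIV"
    unfolding C1_differentiable_on_def by (auto simp: has_real_derivative_iff_has_vector_derivative)
qed

lemma test_fun_derivs:
  assumes "\<phi> \<in> test_fun"
  shows "(\<phi> has_real_derivative deriv \<phi> x) (at x)" "continuous_on S (deriv \<phi>)" "continuous_on S \<phi>"
proof -
  have "\<phi> C1_differentiable_on UNIV"
    using assms by (simp add: test_fun_def)
  then have *: "\<And>x. (\<phi> has_real_derivative deriv \<phi> x) (at x)" "continuous_on UNIV (deriv \<phi>)"
    using C1_UNIV_iff by blast+
  then show "(\<phi> has_real_derivative deriv \<phi> x) (at x)" "continuous_on S (deriv \<phi>)"
    using continuous_on_subset by blast+
  show "continuous_on S \<phi>"
    using *(1) by (meson DERIV_isCont continuous_at_imp_continuous_on)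
qed

lemma test_fun_endpoints:
  assumes "\<phi> \<in> test_fun"
  shows "\<phi> 0 = 0" "\<phi> 1 = 0"
proof -
  obtain a b where "0 < a" "a < b" "b < 1" "\<forall>x. x \<notin> {a..b} \<longrightarrow> \<phi> x = 0"
    using test_funE[OF assms] .
  then show "\<phi> 0 = 0" "\<phi> 1 = 0"
    by simp_all
qed

lemma test_fun_diff:
  assumes "\<phi> \<in> test_fun" "\<psi> \<in> test_fun"
  shows "(\<lambda>x. \<phi> x - c * \<psi> x) \<in> test_fun"
proof -
  obtain a b where 1: "0 < a" "a < b" "b < 1" "\<forall>x. x \<notin> {a..b} \<longrightarrow> \<phi> x = 0"
    using test_funE[OF assms(1)] .
  obtain a' b' where 2: "0 < a'" "a' < b'" "b' < 1" "\<forall>x. x \<notin> {a'..b'} \<longrightarrow> \<psi> x = 0"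
    using test_funE[OF assms(2)] .
  show ?thesis
  proof (rule test_funI[where a = "min a a'" and b = "max b b'"])
    show "(\<lambda>x. \<phi> x - c * \<psi> x) C1_differentiable_on UNIV"
      using assms by (intro derivative_intros) (auto simp: test_fun_def)
    fix x assume "x \<notin> {min a a'..max b b'}"
    then have "x \<notin> {a..b}" "x \<notin> {a'..b'}" by auto
    then show "\<phi> x - c * \<psi> x = 0" using 1(4) 2(4) by simp
  qed (use 1 2 in auto)
qed

text \<open>Squaring removes the kink of the positive part. The result is the C^1 building block of
  the cut-off functions.\<close>

lemma max0_square_C1: "(\<lambda>x::real. (max 0 x)\<^sup>2) C1_differentiable_on UNIV"
  unfolding C1_differentiable_on_def
proof (intro exI conjI ballI)
  show "continuous_on UNIV (\<lambda>x::real. 2 * max 0 x)"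
    by (intro continuous_intros)
  fix x :: real
  have "((\<lambda>x. (max 0 x)\<^sup>2) has_real_derivative 2 * max 0 x) (at x)"
  proof (cases x "0 :: real" rule: linorder_cases)
    case less
    have "((\<lambda>x. 0) has_real_derivative 2 * max 0 x) (at x)"
      using less by (auto intro!: derivative_eq_intros)
    then show ?thesis
      by (rule has_field_derivative_transform_within[where d = "-x"]) (use less in \<open>auto simp: dist_real_def\<close>)
  next
    case greater
    have "((\<lambda>x. x\<^sup>2) has_real_derivative 2 * max 0 x) (at x)"
      using greater by (auto intro!: derivative_eq_intros)
    then show ?thesis
      by (rule has_field_derivative_transform_within[where d = "x"]) (use greater in \<open>auto simp: dist_real_def\<close>)
  next
    case equal
    \<comment> \<open>The difference quotient at 0 is at most |y| in absolute value.\<close>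
    have "((\<lambda>y. (max 0 y)\<^sup>2 / y) \<longlongrightarrow> 0) (at (0::real))"
    proof (rule Lim_null_comparison)
      show "\<forall>\<^sub>F y in at (0::real). norm ((max 0 y)\<^sup>2 / y) \<le> \<bar>y\<bar>"
        by (rule always_eventually) (auto simp: max_def power2_eq_square)
      show "((\<lambda>y. \<bar>y\<bar>) \<longlongrightarrow> 0) (at (0::real))"
        using tendsto_rabs[OF tendsto_ident_at, of "0::real" UNIV] by simp
    qed
    then show ?thesis
      using equal by (simp add: has_field_derivative_iff)
  qed
  then show "((\<lambda>x. (max 0 x)\<^sup>2) has_vector_derivative 2 * max 0 x) (at x)"
    by (simp add: has_real_derivative_iff_has_vector_derivative)
qed

text \<open>With \<open>z n\<close> the squared positive part of a parabola that is positive exactly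
  between \<open>a n\<close> and \<open>1 - a n\<close>, the function \<open>w n\<close> equals n z
  / (1 + n z): it vanishes where \<open>z n\<close> does and tends to 1 where n z tends to infinity,
  that is, throughout the open interval.\<close>

lemma cutoff_sequence:
  obtains w :: "nat \<Rightarrow> real \<Rightarrow> real" where
    "\<And>n. w n \<in> test_fun" "\<And>n x. 0 \<le> w n x" "\<And>n x. w n x \<le> 1"
    "\<And>x. 0 < x \<Longrightarrow> x < 1 \<Longrightarrow> (\<lambda>n. w n x) \<longlonglongrightarrow> 1"
proof -
  \<comment> \<open>The summand 3 keeps \<open>a n\<close> below 1/2, so that the parabola is
    nonpositive outside \<open>{a n..1 - a n}\<close>.\<close>
  define a :: "nat \<Rightarrow> real" where "a n = 1 / (real n + 3)" for n
  define z where "z n x = (max 0 ((x - a n) * (1 - a n - x)))\<^sup>2" for n x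
  define w where "w n x = 1 - 1 / (1 + real n * z n x)" for n x
  have z0: "0 \<le> z n x" for n x by (simp add: z_def)
  have pos: "0 < 1 + real n * z n x" for n x
    using z0[of n x] by (simp add: add_pos_nonneg)
  have a: "0 < a n" "a n \<le> 1/3" for n by (auto simp: a_def field_simps)
  have alim: "a \<longlonglongrightarrow> 0" unfolding a_def by real_asymp
  show thesis
  proof
    fix n x
    show "0 \<le> w n x" "w n x \<le> 1"
      using pos[of n x] z0[of n x] by (auto simp: w_def field_simps)
  next
    fix n
    show "w n \<in> test_fun"
    proof (rule test_funI[where a = "a n" and b = "1 - a n"])
      fix x assume "x \<notin> {a n..1 - a n}"
      then have "(x - a n) * (1 - a n - x) \<le> 0"
        using a[of n] by (auto simp: mult_le_0_iff)
      then show "w n x = 0" by (simp add: w_def z_def)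
    next
      obtain D where D: "\<And>x. ((\<lambda>x::real. (max 0 x)\<^sup>2) has_real_derivative D x) (at x)" "continuous_on UNIV D"
        using max0_square_C1
        unfolding C1_differentiable_on_def by (auto simp: has_real_derivative_iff_has_vector_derivative)
      define q where "q x = (x - a n) * (1 - a n - x)" for x
      have q: "(q has_real_derivative (1 - 2 * x)) (at x)" for x
        unfolding q_def by (auto intro!: derivative_eq_intros simp: algebra_simps)
      have zd: "(z n has_real_derivative D (q x) * (1 - 2 * x)) (at x)" for x
        using DERIV_chain2[OF D(1)[of "q x"] q] by (simp add: z_def[abs_def] q_def)
      have wd: "(w n has_real_derivative
          real n * (D (q x) * (1 - 2 * x)) / (1 + real n * z n x)\<^sup>2) (at x)" for x
        unfolding w_def[abs_def] using pos[of n x]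
        by (auto intro!: derivative_eq_intros zd simp: power2_eq_square)
      have "continuous_on UNIV (\<lambda>x. D (q x))"
        by (rule continuous_on_compose2[OF D(2)]) (auto simp: q_def intro!: continuous_intros)
      moreover have "continuous_on UNIV (z n)"
        using zd by (meson DERIV_isCont continuous_at_imp_continuous_on)
      ultimately have "continuous_on UNIV (\<lambda>x. real n * (D (q x) * (1 - 2 * x)) / (1 + real n * z n x)\<^sup>2)"
        using pos by (intro continuous_intros) (auto simp: less_imp_neq[OF pos, symmetric])
      then show "w n C1_differentiable_on UNIV"
        using wd unfolding C1_differentiable_on_def has_real_derivative_iff_has_vector_derivative
        by (intro exI conjI ballI)
    qed (use a[of n] in auto)
  next
    fix x :: real assume x: "0 < x" "x < 1"
    have "(\<lambda>n. z n x) \<longlonglongrightarrow> (max 0 ((x - 0) * (1 - 0 - x)))\<^sup>2"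
      unfolding z_def by (intro tendsto_intros alim)
    moreover have "(max 0 ((x - 0) * (1 - 0 - x)))\<^sup>2 > 0"
      using x by simp
    ultimately have "filterlim (\<lambda>n. z n x * real n) at_top sequentially"
      by (intro filterlim_tendsto_pos_mult_at_top filterlim_real_sequentially)
    then have "filterlim (\<lambda>n. 1 + real n * z n x) at_top sequentially"
      by (intro filterlim_tendsto_add_at_top[OF tendsto_const]) (simp add: mult.commute)
    then have "(\<lambda>n. 1 / (1 + real n * z n x)) \<longlonglongrightarrow> 0"
      by (rule real_tendsto_divide_at_top[OF tendsto_const])
    then show "(\<lambda>n. w n x) \<longlonglongrightarrow> 1"
      unfolding w_def using tendsto_diff[OF tendsto_const, of _ 0 sequentially 1] by fastforce
  qed
qed

text \<open>
  Continuous approximants of \<open>s\<close> are truncated, replaced by polynomials uniformly close on \<open>[0,1]\<close>,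
  and cut off.
\<close>

lemma test_fun_approx:
  assumes s: "s \<in> borel_measurable unit_meas" and B: "\<And>x. 0 < x \<Longrightarrow> x < 1 \<Longrightarrow> \<bar>s x\<bar> \<le> B"
  obtains \<phi> :: "nat \<Rightarrow> real \<Rightarrow> real" where
    "\<forall>n. \<phi> n \<in> test_fun" "\<forall>n x. \<bar>\<phi> n x\<bar> \<le> B + 1" "AE x in unit_meas. (\<lambda>n. \<phi> n x) \<longlonglongrightarrow> s x"
proof -
  have B0: "0 \<le> B" using B[of "1/2"] by simp
  \<comment> \<open>\<open>measurable_on\<close> supplies continuous functions that converge to
    \<open>s\<close> off a negligible set.\<close>
  have "s measurable_on {0<..<1}"
    using s by (simp add: measurable_on_iff_borel_measurable)
  then obtain N g where N: "negligible N" and g: "\<And>n::nat. continuous_on UNIV (g n)"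
    and lim: "\<And>x. x \<notin> N \<Longrightarrow> (\<lambda>n. g n x) \<longlonglongrightarrow> (if x \<in> {0<..<1} then s x else 0)"
    unfolding measurable_on_def by blast
  define h where "h n x = max (-B) (min B (g n x))" for n x
  have h: "continuous_on {0..1} (h n)" for n
    unfolding h_def by (intro continuous_intros continuous_on_subset[OF g]) auto
  \<comment> \<open>\<open>h n\<close> is merely continuous while test functions must be C^1; hence
    the passage to polynomials.\<close>
  have "\<exists>p. real_polynomial_function p \<and> (\<forall>x\<in>{0..1}. \<bar>h n x - p x\<bar> < 1 / (real n + 1))" for n
    using Stone_Weierstrass_real_polynomial_function[OF compact_Icc h, of "1 / (real n + 1)" n]
    by (metis add.commute of_nat_0_le_iff add_nonneg_pos zero_less_one zero_less_divide_1_iff)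
  then obtain p where p: "\<And>n. real_polynomial_function (p n)"
    "\<And>n x. x \<in> {0..1} \<Longrightarrow> \<bar>h n x - p n x\<bar> < 1 / (real n + 1)"
    by metis
  obtain w :: "nat \<Rightarrow> real \<Rightarrow> real" where w: "\<And>n. w n \<in> test_fun" "\<And>n x. 0 \<le> w n x" "\<And>n x. w n x \<le> 1"
    "\<And>x. 0 < x \<Longrightarrow> x < 1 \<Longrightarrow> (\<lambda>n. w n x) \<longlonglongrightarrow> 1"
    using cutoff_sequence by blast
  have test_bound: "(\<lambda>x. w n x * p n x) \<in> test_fun \<and> (\<forall>x. \<bar>w n x * p n x\<bar> \<le> B + 1)" for n
  proof (intro conjI allI)
    obtain a b where ab: "0 < a" "a < b" "b < 1" "\<forall>x. x \<notin> {a..b} \<longrightarrow> w n x = 0"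
      using test_funE[OF w(1)[of n]] .
    obtain p' where p': "real_polynomial_function p'" "\<And>x. (p n has_real_derivative p' x) (at x)"
      using has_real_derivative_polynomial_function[OF p(1)[of n]] by blast
    have "p n C1_differentiable_on UNIV"
      unfolding C1_differentiable_on_def
      using p' continuous_on_polymonial_function[of p' UNIV]
      by (auto simp: has_real_derivative_iff_has_vector_derivative real_polynomial_function_eq)
    then show "(\<lambda>x. w n x * p n x) \<in> test_fun"
      using ab w(1)[of n]
      by (intro test_funI[where a = a and b = b]) (auto intro!: derivative_intros simp: test_fun_def)
    fix x
    show "\<bar>w n x * p n x\<bar> \<le> B + 1"
    proof (cases "x \<in> {a..b}")
      case True
      then have "\<bar>h n x - p n x\<bar> < 1 / (real n + 1)"
        using ab p(2) by auto
      \<comment> \<open>This error bound accounts for the extra 1 in \<open>B + 1\<close>.\<close>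
      moreover have "1 / (real n + 1) \<le> 1" by (simp add: field_simps)
      moreover have "\<bar>h n x\<bar> \<le> B" using B0 by (auto simp: h_def)
      ultimately have "\<bar>p n x\<bar> \<le> B + 1" by linarith
      then show ?thesis
        using w(2)[of n x] w(3)[of n x] mult_mono[of "w n x" 1 "\<bar>p n x\<bar>" "B + 1"] by (simp add: abs_mult)
    qed (use ab B0 in auto)
  qed
  have "AE x in unit_meas. (\<lambda>n. w n x * p n x) \<longlonglongrightarrow> s x"
  proof -
    have "AE x in lebesgue. x \<notin> N"
      using N by (simp add: negligible_iff_null_sets AE_not_in)
    then have "AE x in unit_meas. x \<notin> N"
      by (simp add: AE_restrict_space_iff) (auto elim: eventually_mono)
    then show ?thesis
    proof (rule AE_mp, intro AE_unitI impI)
      fix x :: real assume x: "0 < x" "x < 1" "x \<notin> N"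
      have "(\<lambda>n. h n x) \<longlonglongrightarrow> max (-B) (min B (s x))"
        unfolding h_def using lim[OF x(3)] x by (intro tendsto_intros) auto
      then have "(\<lambda>n. h n x) \<longlonglongrightarrow> s x" using B[OF x(1,2)] by (simp add: max_def min_def abs_le_iff split: if_splits)
      moreover have "(\<lambda>n. h n x - p n x) \<longlonglongrightarrow> 0"
      proof (rule Lim_null_comparison)
        show "\<forall>\<^sub>F n in sequentially. norm (h n x - p n x) \<le> 1 / (real n + 1)"
          using p(2)[of x] x by (intro always_eventually) (auto intro: less_imp_le)
        show "(\<lambda>n. 1 / (real n + 1)) \<longlonglongrightarrow> 0" by real_asymp
      qed
      ultimately have "(\<lambda>n. p n x) \<longlonglongrightarrow> s x"
        using tendsto_diff by fastforce
      then show "(\<lambda>n. w n x * p n x) \<longlonglongrightarrow> s x"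
        using tendsto_mult[OF w(4)[OF x(1,2)]] by fastforce
    qed
  qed
  with test_bound show thesis
    by (intro that[of "\<lambda>n x. w n x * p n x"]) simp_all
qed

section \<open>Primitives on the unit interval\<close>

lemma test_fun_measurable:
  assumes "\<phi> \<in> test_fun"
  shows "\<phi> \<in> borel_measurable unit_meas" "deriv \<phi> \<in> borel_measurable unit_meas"
  using test_fun_derivs[OF assms] by (auto intro!: measurable_unit_continuous)

text \<open>Test functions bounded by 2 approximate the sign of \<open>h\<close> almost everywhere.
  As \<open>2 * \<bar>h x\<bar>\<close> dominates the products, orthogonality says in the limit that
  the integral of |h| is zero.\<close>

lemma AE_zero_of_test_fun:
  assumes h: "integrable unit_meas h"
    and orth: "\<And>\<phi>. \<phi> \<in> test_fun \<Longrightarrow> (LINT x|unit_meas. h x * \<phi> x) = 0"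
  shows "AE x in unit_meas. h x = 0"
proof -
  have [measurable]: "h \<in> borel_measurable unit_meas" using h by simp
  have m: "(\<lambda>x. sgn (h x)) \<in> borel_measurable unit_meas" by measurable
  have "\<bar>sgn (h x)\<bar> \<le> 1" for x by (simp add: abs_sgn_eq)
  with m obtain \<phi> :: "nat \<Rightarrow> real \<Rightarrow> real" where \<phi>:
    "\<forall>n. \<phi> n \<in> test_fun" "\<forall>n x. \<bar>\<phi> n x\<bar> \<le> 1 + 1"
    "AE x in unit_meas. (\<lambda>n. \<phi> n x) \<longlonglongrightarrow> sgn (h x)"
    by (rule test_fun_approx)
  note \<phi> = \<phi>(1,2)[rule_format] \<phi>(3)
  have [measurable]: "\<phi> n \<in> borel_measurable unit_meas" for n
    by (rule test_fun_measurable[OF \<phi>(1)])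
  have "(\<lambda>n. LINT x|unit_meas. h x * \<phi> n x) \<longlonglongrightarrow> (LINT x|unit_meas. h x * sgn (h x))"
  proof (rule LINT_dominated_unit[where w = "\<lambda>x. 2 * \<bar>h x\<bar>"])
    show "\<bar>h x * \<phi> n x\<bar> \<le> 2 * \<bar>h x\<bar>" for n x
      using mult_left_mono[OF \<phi>(2)[of n x], of "\<bar>h x\<bar>"] by (simp add: abs_mult mult.commute)
    show "AE x in unit_meas. (\<lambda>n. h x * \<phi> n x) \<longlonglongrightarrow> h x * sgn (h x)"
      using \<phi>(3) by eventually_elim (intro tendsto_intros)
  qed (use h m in auto)
  then have "(LINT x|unit_meas. h x * sgn (h x)) = 0"
    using orth[OF \<phi>(1)] by (simp add: LIMSEQ_const_iff)
  then have "(LINT x|unit_meas. \<bar>h x\<bar>) = 0"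
    by (simp add: abs_sgn)
  then have "AE x in unit_meas. \<bar>h x\<bar> = 0"
    using integral_nonneg_eq_0_iff_AE[of unit_meas "\<lambda>x. \<bar>h x\<bar>"] h by simp
  then show ?thesis by simp
qed

text \<open>The indicator lets every \<open>x\<close> use the same measure space, so that linearity
  and dominated convergence apply directly. On [0,1] this is the integral from 0 to
  \<open>x\<close>.\<close>

definition primitive :: "(real \<Rightarrow> real) \<Rightarrow> real \<Rightarrow> real" where
  "primitive f x = (LINT y|unit_meas. indicat_real {..x} y * f y)"

lemma integrable_indicator_times:
  assumes "integrable unit_meas f"
  shows "integrable unit_meas (\<lambda>y. indicat_real {..x} y * f y)"
proof (rule Bochner_Integration.integrable_bound[OF assms])
  have [measurable]: "indicat_real {..x} \<in> borel_measurable unit_meas"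
    by (rule measurable_unit_borel) simp
  have [measurable]: "f \<in> borel_measurable unit_meas" using assms by simp
  show "(\<lambda>y. indicat_real {..x} y * f y) \<in> borel_measurable unit_meas" by measurable
qed (auto simp: indicator_def)

lemma primitive_diff:
  assumes "integrable unit_meas f" "integrable unit_meas g"
  shows "primitive (\<lambda>y. f y - g y) x = primitive f x - primitive g x"
  unfolding primitive_def right_diff_distrib
  by (intro Bochner_Integration.integral_diff integrable_indicator_times assms)

lemma primitive_0: "primitive f 0 = 0"
proof -
  have "primitive f 0 = (LINT y|unit_meas. 0)"
    unfolding primitive_def by (rule Bochner_Integration.integral_cong) (auto simp: indicator_def)
  then show ?thesis by simp
qed

lemma primitive_1: "primitive f 1 = (LINT y|unit_meas. f y)"
  unfolding primitive_def by (rule Bochner_Integration.integral_cong) (auto simp: indicator_def)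

lemma abs_primitive_le:
  assumes "integrable unit_meas f"
  shows "\<bar>primitive f x\<bar> \<le> (LINT y|unit_meas. \<bar>f y\<bar>)"
proof -
  have "\<bar>primitive f x\<bar> \<le> (LINT y|unit_meas. \<bar>indicat_real {..x} y * f y\<bar>)"
    unfolding primitive_def by (rule integral_abs_bound)
  also have "\<dots> \<le> (LINT y|unit_meas. \<bar>f y\<bar>)"
    by (rule integral_mono[OF integrable_abs[OF integrable_indicator_times[OF assms]] integrable_abs[OF assms]])
      (auto simp: indicator_def)
  finally show ?thesis .
qed

lemma primitive_cong_AE:
  assumes "AE x in unit_meas. f x = g x" "f \<in> borel_measurable unit_meas" "g \<in> borel_measurable unit_meas"
  shows "primitive f x = primitive g x"
proof -
  have [measurable]: "indicat_real {..x} \<in> borel_measurable unit_meas"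
    by (rule measurable_unit_borel) simp
  note [measurable] = assms(2,3)
  show ?thesis
    unfolding primitive_def
    by (rule integral_cong_AE) (use assms(1) in \<open>auto\<close>)
qed

text \<open>Passage from the Lebesgue to the gauge integral, for which the fundamental theorem of
  calculus is stated; the two integration sets differ at most by the points 0 and 1.\<close>

lemma primitive_eq_integral:
  assumes "integrable unit_meas f" "0 \<le> x" "x \<le> 1"
  shows "primitive f x = integral {0..x} f" and "f integrable_on {0..x}"
proof -
  have i: "f integrable_on {0<..<1}"
    by (rule integrable_on_lebesgue_on[OF assms(1)]) simp
  have "primitive f x = integral {0<..<1} (\<lambda>y. indicat_real {..x} y * f y)"
    unfolding primitive_def
    by (rule lebesgue_integral_eq_integral) (auto intro: integrable_indicator_times assms)
  also have "\<dots> = integral {0<..<1} (\<lambda>y. if y \<in> {..x} then f y else 0)"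
    by (rule integral_cong) (auto simp: indicator_def)
  also have "\<dots> = integral ({..x} \<inter> {0<..<1}) f"
    by (rule integral_restrict_Int)
  also have "\<dots> = integral {0..x} f"
  proof (rule integral_spike_set)
    show "negligible {y \<in> {..x} \<inter> {0<..<1} - {0..x}. f y \<noteq> 0}"
      by (rule negligible_subset[of "{}"]) auto
    show "negligible {y \<in> {0..x} - {..x} \<inter> {0<..<1}. f y \<noteq> 0}"
      by (rule negligible_subset[of "{0, 1}"]) (use assms in auto)
  qed
  finally show "primitive f x = integral {0..x} f" .
  have "f integrable_on {0..1}"
    using i integrable_on_open_interval_real by blast
  then show "f integrable_on {0..x}"
    by (rule integrable_on_subinterval) (use assms in auto)
qed

lemma primitive_continuous:
  assumes "integrable unit_meas f"
  shows "continuous_on {0..1} (primitive f)"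
proof -
  have "continuous_on {0..1} (\<lambda>x. integral {0..x} f)"
    by (rule indefinite_integral_continuous_1) (rule primitive_eq_integral(2)[OF assms], auto)
  then show ?thesis
    by (rule continuous_on_eq) (simp add: primitive_eq_integral(1)[OF assms])
qed

lemma primitive_of_derivative:
  assumes f': "integrable unit_meas f'" and f: "continuous_on {0..1} f"
    and S: "finite S" "\<And>x. 0 < x \<Longrightarrow> x < 1 \<Longrightarrow> x \<notin> S \<Longrightarrow> (f has_real_derivative f' x) (at x)"
    and x: "0 \<le> x" "x \<le> 1"
  shows "primitive f' x = f x - f 0"
proof -
  have "(f' has_integral (f x - f 0)) {0..x}"
    by (rule fundamental_theorem_of_calculus_interior_strong[OF S(1) x(1)])
      (use S(2) x in \<open>auto simp: has_real_derivative_iff_has_vector_derivative intro: continuous_on_subset[OF f]\<close>)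
  then show ?thesis
    using primitive_eq_integral(1)[OF f' x] by (simp add: integral_unique)
qed

lemma primitive_has_derivative:
  assumes f: "continuous_on {0..1} f" and x: "0 \<le> x" "x \<le> 1"
  shows "(primitive f has_real_derivative f x) (at x within {0..1})"
proof -
  have "((\<lambda>x. integral {0..x} f) has_real_derivative f x) (at x within {0..1})"
    using integral_has_real_derivative[OF f] x by simp
  then show ?thesis
    by (rule has_field_derivative_transform_within[where d = 1])
      (use x in \<open>auto simp: primitive_eq_integral(1)[OF integrable_unit_continuous[OF f]]\<close>)
qed

section \<open>Integration by parts and approximation by derivatives of test functions\<close>

lemma LINT_deriv_unit:
  assumes f': "integrable unit_meas f'" and f: "continuous_on {0..1} f"
    and S: "finite S" "\<And>x. 0 < x \<Longrightarrow> x < 1 \<Longrightarrow> x \<notin> S \<Longrightarrow> (f has_real_derivative f' x) (at x)"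
  shows "(LINT x|unit_meas. f' x) = f 1 - f 0"
  using primitive_of_derivative[OF f' f S, of 1] by (simp add: primitive_1)

lemma test_fun_primitive:
  assumes \<phi>: "\<phi> \<in> test_fun" and x: "0 \<le> x" "x \<le> 1"
  shows "\<phi> x = primitive (deriv \<phi>) x"
  using primitive_of_derivative[of "deriv \<phi>" \<phi> "{}" x] test_fun_derivs[OF \<phi>] test_fun_endpoints[OF \<phi>] x
  by (simp add: integrable_unit_continuous)

text \<open>Integrate the derivative of \<open>V x * \<phi> x\<close>; the boundary terms vanish
  because \<phi> is zero at 0 and 1.\<close>

lemma LINT_test_fun_by_parts:
  assumes \<phi>: "\<phi> \<in> test_fun" and V: "continuous_on {0..1} V" "continuous_on {0..1} V'"
    and d: "\<And>x. 0 < x \<Longrightarrow> x < 1 \<Longrightarrow> (V has_real_derivative V' x) (at x)"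
  shows "(LINT x|unit_meas. V x * deriv \<phi> x) = - (LINT x|unit_meas. V' x * \<phi> x)"
proof -
  have i: "integrable unit_meas (\<lambda>x. V x * deriv \<phi> x)" "integrable unit_meas (\<lambda>x. V' x * \<phi> x)"
    by (intro integrable_unit_continuous continuous_intros V test_fun_derivs[OF \<phi>])+
  have "(LINT x|unit_meas. V x * deriv \<phi> x + V' x * \<phi> x) = V 1 * \<phi> 1 - V 0 * \<phi> 0"
  proof (rule LINT_deriv_unit[where S = "{}"])
    show "continuous_on {0..1} (\<lambda>x. V x * \<phi> x)"
      by (intro continuous_intros V test_fun_derivs[OF \<phi>])
    fix x :: real assume x: "0 < x" "x < 1"
    show "((\<lambda>x. V x * \<phi> x) has_real_derivative V x * deriv \<phi> x + V' x * \<phi> x) (at x)"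
      by (rule derivative_eq_intros d[OF x] test_fun_derivs(1)[OF \<phi>] refl)+ (simp add: algebra_simps)
  qed (use i in auto)
  then show ?thesis
    using i test_fun_endpoints[OF \<phi>] by simp
qed

lemma test_fun_by_parts:
  assumes "\<phi> \<in> test_fun" "\<psi> \<in> test_fun"
  shows "(LINT x|unit_meas. \<phi> x * deriv \<psi> x) = - (LINT x|unit_meas. deriv \<phi> x * \<psi> x)"
  by (rule LINT_test_fun_by_parts[OF assms(2)]) (rule test_fun_derivs[OF assms(1)])+

text \<open>An antiderivative is constant on either side of the support of \<phi>. Normalising at 0
  makes the left constant zero and the vanishing mean makes the right one zero, so the support stays
  within \<open>{a..b}\<close>.\<close>

lemma test_fun_antiderivative:
  assumes \<phi>: "\<phi> \<in> test_fun" and 0: "(LINT x|unit_meas. \<phi> x) = 0"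
  obtains \<Phi> where "\<Phi> \<in> test_fun" "deriv \<Phi> = \<phi>"
proof -
  have "isCont \<phi> x" for x
    using test_fun_derivs(1)[OF \<phi>] by (rule DERIV_isCont)
  then obtain F where F: "\<And>x. (F has_real_derivative \<phi> x) (at x)"
    using einterval_antiderivative[of "-\<infinity>" "\<infinity>" \<phi>]
    by (auto simp: has_real_derivative_iff_has_vector_derivative)
  define \<Phi> where "\<Phi> x = F x - F 0" for x
  have d: "(\<Phi> has_real_derivative \<phi> x) (at x)" for x
    unfolding \<Phi>_def[abs_def] by (auto intro!: derivative_eq_intros F)
  then have der: "deriv \<Phi> = \<phi>"
    by (auto intro: DERIV_imp_deriv)
  obtain a b where ab: "0 < a" "a < b" "b < 1" "\<forall>x. x \<notin> {a..b} \<longrightarrow> \<phi> x = 0"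
    using test_funE[OF \<phi>] .
  have F1: "\<Phi> 1 = 0" "\<Phi> 0 = 0"
  proof -
    have "(LINT x|unit_meas. \<phi> x) = \<Phi> 1 - \<Phi> 0"
      by (rule LINT_deriv_unit[where S = "{}"])
        (auto intro!: integrable_unit_continuous test_fun_derivs[OF \<phi>] d
          intro: continuous_at_imp_continuous_on DERIV_isCont[OF d])
    then show "\<Phi> 1 = 0" "\<Phi> 0 = 0"
      using 0 by (auto simp: \<Phi>_def)
  qed
  have zero: "\<Phi> x = 0" if "x \<notin> {a..b}" for x
  proof (cases "x < a")
    case True
    have "\<exists>c. \<forall>x\<in>{..<a}. \<Phi> x = c"
      by (rule has_field_derivative_zero_constant)
        (use d ab in \<open>auto intro: has_field_derivative_at_within simp: convex_real_interval\<close>,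
         metis atLeastAtMost_iff has_field_derivative_at_within not_less)
    then show ?thesis using F1(2) ab True by (metis lessThan_iff)
  next
    case False
    have "\<exists>c. \<forall>x\<in>{b<..}. \<Phi> x = c"
      by (rule has_field_derivative_zero_constant)
        (use d ab in \<open>auto intro: has_field_derivative_at_within simp: convex_real_interval\<close>,
         metis atLeastAtMost_iff has_field_derivative_at_within not_less)
    then show ?thesis using F1(1) ab False that by (metis greaterThan_iff atLeastAtMost_iff not_less)
  qed
  have "\<Phi> \<in> test_fun"
  proof (rule test_funI[OF _ ab(1,3) zero])
    show "\<Phi> C1_differentiable_on UNIV"
      unfolding C1_UNIV_iff der using d test_fun_derivs(3)[OF \<phi>] by blast
  qed
  then show thesis using that der by blast
qed

text \<open>A test function with mean zero is the derivative of a test function. The approximants of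
  \<open>s\<close> are therefore corrected to mean zero, by amounts that tend to zero because
  \<open>s\<close> itself has mean zero, and then integrated.\<close>

lemma test_fun_deriv_approx:
  assumes s: "s \<in> borel_measurable unit_meas" and B: "\<And>x. 0 < x \<Longrightarrow> x < 1 \<Longrightarrow> \<bar>s x\<bar> \<le> B"
    and mean: "(LINT x|unit_meas. s x) = 0"
  obtains \<Phi> :: "nat \<Rightarrow> real \<Rightarrow> real" and C where
    "\<forall>n. \<Phi> n \<in> test_fun" "\<forall>n x. \<bar>deriv (\<Phi> n) x\<bar> \<le> C" "AE x in unit_meas. (\<lambda>n. deriv (\<Phi> n) x) \<longlonglongrightarrow> s x"
proof -
  obtain \<phi> :: "nat \<Rightarrow> real \<Rightarrow> real" where \<phi>:
    "\<forall>n. \<phi> n \<in> test_fun" "\<forall>n x. \<bar>\<phi> n x\<bar> \<le> B + 1"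
    "AE x in unit_meas. (\<lambda>n. \<phi> n x) \<longlonglongrightarrow> s x"
    using test_fun_approx[OF s B] .
  note \<phi> = \<phi>(1,2)[rule_format] \<phi>(3)
  \<comment> \<open>Applied to the constant 1, the approximation yields a test function with nonzero
    integral, the bump \<open>\<theta> m\<close> used for the correction.\<close>
  have "\<bar>1 :: real\<bar> \<le> 1" by simp
  from test_fun_approx[OF borel_measurable_const this]
  obtain \<theta> :: "nat \<Rightarrow> real \<Rightarrow> real" where \<theta>:
    "\<forall>n. \<theta> n \<in> test_fun" "\<forall>n x. \<bar>\<theta> n x\<bar> \<le> 1 + 1"
    "AE x in unit_meas. (\<lambda>n. \<theta> n x) \<longlonglongrightarrow> 1"
    .
  note \<theta> = \<theta>(1,2)[rule_format] \<theta>(3)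
  have lim: "(\<lambda>n. LINT x|unit_meas. \<theta> n x) \<longlonglongrightarrow> (LINT x|unit_meas. 1)"
    by (rule LINT_dominated_unit[where w = "\<lambda>_. 2"])
      (use \<theta>(2,3) test_fun_measurable(1)[OF \<theta>(1)] in \<open>simp_all add: integrable_unit_continuous\<close>)
  have "\<exists>n. (LINT x|unit_meas. \<theta> n x) \<noteq> 0"
  proof (rule ccontr)
    assume "\<nexists>n. (LINT x|unit_meas. \<theta> n x) \<noteq> 0"
    with lim[unfolded LINT_const_unit] show False by (simp add: LIMSEQ_const_iff)
  qed
  then obtain m where m: "(LINT x|unit_meas. \<theta> m x) \<noteq> 0" by blast
  define c where "c n = (LINT x|unit_meas. \<phi> n x) / (LINT x|unit_meas. \<theta> m x)" for n
  have "(\<lambda>n. LINT x|unit_meas. \<phi> n x) \<longlonglongrightarrow> (LINT x|unit_meas. s x)"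
    by (rule LINT_dominated_unit[where w = "\<lambda>_. B + 1"])
      (use \<phi>(2,3) s test_fun_measurable(1)[OF \<phi>(1)] in \<open>simp_all add: integrable_unit_continuous\<close>)
  then have c0: "c \<longlonglongrightarrow> 0"
    unfolding c_def using mean m tendsto_divide[OF _ tendsto_const] by fastforce
  then obtain K where K: "\<And>n. \<bar>c n\<bar> \<le> K"
    using convergent_imp_Bseq[of c] by (metis BseqE convergent_def real_norm_def)
  \<comment> \<open>subtracting a multiple of a fixed bump makes the approximants integrate to zero\<close>
  define \<psi> where "\<psi> n x = \<phi> n x - c n * \<theta> m x" for n x
  have \<psi>: "\<psi> n \<in> test_fun" for n
    unfolding \<psi>_def by (rule test_fun_diff[OF \<phi>(1) \<theta>(1)])
  have "(LINT x|unit_meas. \<psi> n x) = 0" for n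
  proof -
    have "(LINT x|unit_meas. \<psi> n x) = (LINT x|unit_meas. \<phi> n x) - (LINT x|unit_meas. c n * \<theta> m x)"
      unfolding \<psi>_def
      by (intro Bochner_Integration.integral_diff integrable_unit_continuous continuous_intros
          test_fun_derivs(3) \<phi>(1) \<theta>(1))
    then show ?thesis using m by (simp add: c_def)
  qed
  then have "\<exists>\<Phi>. \<Phi> \<in> test_fun \<and> deriv \<Phi> = \<psi> n" for n
    using test_fun_antiderivative[OF \<psi>] by metis
  then obtain \<Phi> where \<Phi>: "\<And>n. \<Phi> n \<in> test_fun" "\<And>n. deriv (\<Phi> n) = \<psi> n" by metis
  show thesis
  proof (rule that)
    show "\<forall>n. \<Phi> n \<in> test_fun" using \<Phi>(1) by blast
    show "\<forall>n x. \<bar>deriv (\<Phi> n) x\<bar> \<le> (B + 1) + K * (1 + 1)"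
    proof (intro allI)
      fix n x
      have "\<bar>\<psi> n x\<bar> \<le> \<bar>\<phi> n x\<bar> + \<bar>c n\<bar> * \<bar>\<theta> m x\<bar>"
        unfolding \<psi>_def by (metis abs_mult abs_triangle_ineq4)
      also have "\<dots> \<le> (B + 1) + K * (1 + 1)"
        using \<phi>(2) \<theta>(2) K by (intro add_mono mult_mono) (auto intro: order_trans[OF abs_ge_zero K])
      finally show "\<bar>deriv (\<Phi> n) x\<bar> \<le> (B + 1) + K * (1 + 1)"
        by (simp add: \<Phi>(2))
    qed
    show "AE x in unit_meas. (\<lambda>n. deriv (\<Phi> n) x) \<longlonglongrightarrow> s x"
      using \<phi>(3)
    proof eventually_elim
      case (elim x)
      have "(\<lambda>n. \<phi> n x - c n * \<theta> m x) \<longlonglongrightarrow> s x - 0 * \<theta> m x"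
        by (intro tendsto_intros elim c0)
      then show ?case by (simp add: \<Phi>(2) \<psi>_def)
    qed
  qed
qed

section \<open>Weak derivatives and the space \<open>H10\<close>\<close>

lemma L2_fun_bounded:
  assumes "f \<in> borel_measurable unit_meas" "\<And>x. 0 < x \<Longrightarrow> x < 1 \<Longrightarrow> \<bar>f x\<bar> \<le> B"
  shows "f \<in> L2_fun"
proof -
  have [measurable]: "f \<in> borel_measurable unit_meas" by fact
  have "integrable unit_meas (\<lambda>x. (f x)\<^sup>2)"
  proof (rule integrable_unit_bounded)
    fix x :: real assume "0 < x" "x < 1"
    then show "\<bar>(f x)\<^sup>2\<bar> \<le> B\<^sup>2"
      using power_mono[OF assms(2), of x 2] by simp
  qed measurable
  then show ?thesis using assms(1) by (simp add: L2_fun_def)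
qed

lemma L2_fun_continuous:
  assumes "continuous_on {0..1} f"
  shows "f \<in> L2_fun"
  unfolding L2_fun_def
  by (auto intro!: measurable_unit_continuous integrable_unit_continuous continuous_intros assms)

lemma L2_fun_measurable: "f \<in> L2_fun \<Longrightarrow> f \<in> borel_measurable unit_meas"
  by (simp add: L2_fun_def)

lemma L2_fun_integrable_mult:
  assumes "f \<in> L2_fun" "g \<in> L2_fun"
  shows "integrable unit_meas (\<lambda>x. f x * g x)"
proof (rule Bochner_Integration.integrable_bound)
  show "integrable unit_meas (\<lambda>x. (f x)\<^sup>2 + (g x)\<^sup>2)"
    using assms by (simp add: L2_fun_def)
  have [measurable]: "f \<in> borel_measurable unit_meas" "g \<in> borel_measurable unit_meas"
    using assms by (simp_all add: L2_fun_def)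
  show "(\<lambda>x. f x * g x) \<in> borel_measurable unit_meas" by measurable
  show "AE x in unit_meas. norm (f x * g x) \<le> norm ((f x)\<^sup>2 + (g x)\<^sup>2)"
  proof (intro AE_I2)
    fix x
    have "2 * (\<bar>f x\<bar> * \<bar>g x\<bar>) \<le> (f x)\<^sup>2 + (g x)\<^sup>2"
      using sum_squares_bound[of "\<bar>f x\<bar>" "\<bar>g x\<bar>"] by simp
    moreover have "0 \<le> \<bar>f x\<bar> * \<bar>g x\<bar>" by simp
    ultimately show "norm (f x * g x) \<le> norm ((f x)\<^sup>2 + (g x)\<^sup>2)"
      unfolding real_norm_def abs_mult by linarith
  qed
qed

lemma L2_fun_integrable:
  assumes "f \<in> L2_fun"
  shows "integrable unit_meas f"
  using L2_fun_integrable_mult[OF assms L2_fun_continuous[of "\<lambda>_. 1"]] by simp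

lemma L2_fun_diff:
  assumes "f \<in> L2_fun" "g \<in> L2_fun"
  shows "(\<lambda>x. f x - g x) \<in> L2_fun"
proof -
  have [measurable]: "f \<in> borel_measurable unit_meas" "g \<in> borel_measurable unit_meas"
    using assms by (simp_all add: L2_fun_def)
  have "integrable unit_meas (\<lambda>x. (f x)\<^sup>2 - 2 * (f x * g x) + (g x)\<^sup>2)"
    using assms L2_fun_integrable_mult[OF assms] by (auto simp: L2_fun_def)
  then show ?thesis
    by (simp add: L2_fun_def power2_diff algebra_simps)
qed

text \<open>This is the Cauchy-Schwarz inequality against the constant 1: the total mass is 1, and
  the variance of |f| is nonnegative.\<close>

lemma LINT_abs_square_le:
  assumes "f \<in> L2_fun"
  shows "(LINT x|unit_meas. \<bar>f x\<bar>)\<^sup>2 \<le> (LINT x|unit_meas. (f x)\<^sup>2)"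
proof -
  define m where "m = (LINT x|unit_meas. \<bar>f x\<bar>)"
  have i: "integrable unit_meas (\<lambda>x. (f x)\<^sup>2)" "integrable unit_meas (\<lambda>x. \<bar>f x\<bar>)"
    "integrable unit_meas (\<lambda>x. m\<^sup>2)"
    using assms L2_fun_integrable[OF assms] by (auto simp: L2_fun_def intro!: integrable_unit_continuous)
  have "0 \<le> (LINT x|unit_meas. (\<bar>f x\<bar> - m)\<^sup>2)"
    by simp
  also have "\<dots> = (LINT x|unit_meas. (f x)\<^sup>2 - 2 * m * \<bar>f x\<bar> + m\<^sup>2)"
    by (simp add: power2_diff algebra_simps)
  also have "\<dots> = (LINT x|unit_meas. (f x)\<^sup>2) - 2 * m * m + m\<^sup>2"
    using i by (subst Bochner_Integration.integral_add Bochner_Integration.integral_diff; simp add: m_def[symmetric] measure_space_unit[simplified])+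
  finally show ?thesis
    by (simp add: m_def[symmetric] power2_eq_square)
qed

section \<open>Weak derivatives\<close>

lemma has_weak_deriv_L2:
  assumes "has_weak_deriv u g"
  shows "u \<in> L2_fun" "g \<in> L2_fun"
  using assms by (auto simp: has_weak_deriv_def)

lemma test_fun_L2:
  assumes "\<phi> \<in> test_fun"
  shows "\<phi> \<in> L2_fun" "deriv \<phi> \<in> L2_fun"
  by (intro L2_fun_continuous test_fun_derivs[OF assms])+

lemma has_weak_deriv_diff:
  assumes "has_weak_deriv u g" "has_weak_deriv v h"
  shows "has_weak_deriv (\<lambda>x. u x - v x) (\<lambda>x. g x - h x)"
  unfolding has_weak_deriv_def
proof (intro conjI ballI)
  note L2 = has_weak_deriv_L2[OF assms(1)] has_weak_deriv_L2[OF assms(2)]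
  show "(\<lambda>x. u x - v x) \<in> L2_fun" "(\<lambda>x. g x - h x) \<in> L2_fun"
    by (intro L2_fun_diff L2)+
  fix \<phi> assume \<phi>: "\<phi> \<in> test_fun"
  have "(LINT x|unit_meas. (u x - v x) * deriv \<phi> x)
      = (LINT x|unit_meas. u x * deriv \<phi> x) - (LINT x|unit_meas. v x * deriv \<phi> x)"
    unfolding left_diff_distrib
    by (intro Bochner_Integration.integral_diff L2_fun_integrable_mult L2 test_fun_L2[OF \<phi>])
  also have "\<dots> = - ((LINT x|unit_meas. g x * \<phi> x) - (LINT x|unit_meas. h x * \<phi> x))"
    using assms \<phi> by (simp add: has_weak_deriv_def)
  also have "(LINT x|unit_meas. g x * \<phi> x) - (LINT x|unit_meas. h x * \<phi> x)
      = (LINT x|unit_meas. (g x - h x) * \<phi> x)"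
    unfolding left_diff_distrib
    by (intro Bochner_Integration.integral_diff[symmetric] L2_fun_integrable_mult L2 test_fun_L2[OF \<phi>])
  finally show "(LINT x|unit_meas. (u x - v x) * deriv \<phi> x) = - (LINT x|unit_meas. (g x - h x) * \<phi> x)" .
qed

lemma has_weak_deriv_unique:
  assumes "has_weak_deriv u g" "has_weak_deriv u h"
  shows "AE x in unit_meas. g x = h x"
proof -
  note d = has_weak_deriv_diff[OF assms]
  have "AE x in unit_meas. g x - h x = 0"
    by (rule AE_zero_of_test_fun[OF L2_fun_integrable[OF has_weak_deriv_L2(2)[OF d]]])
      (use d in \<open>simp add: has_weak_deriv_def\<close>)
  then show ?thesis by simp
qed

text \<open>\<open>weak_deriv\<close> is a choice; this licenses replacing it under integrals by any
  weak derivative at hand.\<close>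

lemma has_weak_deriv_weak_deriv:
  assumes "has_weak_deriv u g"
  shows "has_weak_deriv u (weak_deriv u)" and "AE x in unit_meas. weak_deriv u x = g x"
proof -
  show *: "has_weak_deriv u (weak_deriv u)"
    unfolding weak_deriv_def by (rule someI[of "has_weak_deriv u", OF assms])
  show "AE x in unit_meas. weak_deriv u x = g x"
    by (rule has_weak_deriv_unique[OF * assms])
qed

lemma H1_norm_eq:
  assumes "has_weak_deriv u g"
  shows "H1_norm u = sqrt ((LINT x|unit_meas. (u x)\<^sup>2) + (LINT x|unit_meas. (g x)\<^sup>2))"
proof -
  have [measurable]: "weak_deriv u \<in> borel_measurable unit_meas" "g \<in> borel_measurable unit_meas"
    using has_weak_deriv_L2(2)[OF has_weak_deriv_weak_deriv(1)[OF assms]] has_weak_deriv_L2(2)[OF assms]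
    by (simp_all add: L2_fun_measurable)
  have "(LINT x|unit_meas. (weak_deriv u x)\<^sup>2) = (LINT x|unit_meas. (g x)\<^sup>2)"
    by (rule integral_cong_AE) (use has_weak_deriv_weak_deriv(2)[OF assms] in auto)
  then show ?thesis by (simp add: H1_norm_def)
qed

lemma test_fun_has_weak_deriv:
  assumes "\<phi> \<in> test_fun"
  shows "has_weak_deriv \<phi> (deriv \<phi>)"
  unfolding has_weak_deriv_def
  using test_fun_L2[OF assms] test_fun_by_parts[OF assms] by blast

text \<open>Source of all concrete members of \<open>H10\<close>, both eigenfunctions and elements
  to test with. Test functions whose derivatives are bounded and converge to \<open>s\<close> are
  themselves bounded and converge pointwise to \<open>U\<close>; dominated convergence then passes
  integration by parts to the limit and shows convergence in \<open>H1_norm\<close>.\<close>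

lemma H10_of_primitive:
  assumes s: "s \<in> borel_measurable unit_meas" and B: "\<And>x. 0 < x \<Longrightarrow> x < 1 \<Longrightarrow> \<bar>s x\<bar> \<le> B"
    and mean: "(LINT x|unit_meas. s x) = 0"
    and U: "\<And>x. 0 \<le> x \<Longrightarrow> x \<le> 1 \<Longrightarrow> U x = primitive s x"
  shows "has_weak_deriv U s" and "U \<in> H10"
proof -
  have si: "integrable unit_meas s" by (rule integrable_unit_bounded[OF s B])
  have Uc: "continuous_on {0..1} U"
    using primitive_continuous[OF si] by (rule continuous_on_eq) (use U in auto)
  obtain \<Phi> :: "nat \<Rightarrow> real \<Rightarrow> real" and C where \<Phi>: "\<forall>n. \<Phi> n \<in> test_fun"
    "\<forall>n x. \<bar>deriv (\<Phi> n) x\<bar> \<le> C" "AE x in unit_meas. (\<lambda>n. deriv (\<Phi> n) x) \<longlonglongrightarrow> s x"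
    using test_fun_deriv_approx[OF s B mean] .
  note \<Phi> = \<Phi>(1,2)[rule_format] \<Phi>(3)
  note [measurable] = s measurable_unit_continuous[OF Uc] test_fun_measurable[OF \<Phi>(1)]
  have int: "integrable unit_meas (deriv (\<Phi> n))" for n
    by (rule L2_fun_integrable[OF test_fun_L2(2)[OF \<Phi>(1)]])
  have bounded: "\<bar>\<Phi> n x\<bar> \<le> C" if "0 \<le> x" "x \<le> 1" for n x
  proof -
    have "\<bar>\<Phi> n x\<bar> \<le> (LINT y|unit_meas. \<bar>deriv (\<Phi> n) y\<bar>)"
      unfolding test_fun_primitive[OF \<Phi>(1) that] by (rule abs_primitive_le[OF int])
    also have "\<dots> \<le> (LINT y|unit_meas. C)"
      by (rule integral_mono) (use int \<Phi>(2) integrable_unit_continuous in auto)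
    finally show ?thesis unfolding LINT_const_unit .
  qed
  have C0: "0 \<le> C" using \<Phi>(2)[of 0 0] by linarith
  have lim: "(\<lambda>n. \<Phi> n x) \<longlonglongrightarrow> U x" if x: "0 \<le> x" "x \<le> 1" for x
  proof -
    have "(\<lambda>n. primitive (deriv (\<Phi> n)) x) \<longlonglongrightarrow> primitive s x"
      unfolding primitive_def
    proof (rule LINT_dominated_unit[where w = "\<lambda>_. C"])
      have [measurable]: "indicat_real {..x} \<in> borel_measurable unit_meas"
        by (rule measurable_unit_borel) simp
      show "(\<lambda>y. indicat_real {..x} y * s y) \<in> borel_measurable unit_meas"
        "(\<lambda>y. indicat_real {..x} y * deriv (\<Phi> n) y) \<in> borel_measurable unit_meas" for n
        by measurable
      show "\<bar>indicat_real {..x} y * deriv (\<Phi> n) y\<bar> \<le> C" for n y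
        using \<Phi>(2) C0 by (simp add: indicator_def)
      show "AE y in unit_meas. (\<lambda>n. indicat_real {..x} y * deriv (\<Phi> n) y) \<longlonglongrightarrow> indicat_real {..x} y * s y"
        using \<Phi>(3) by eventually_elim (intro tendsto_intros)
    qed (simp add: integrable_unit_continuous)
    then show ?thesis
      using test_fun_primitive[OF \<Phi>(1) x] U[OF x] by simp
  qed
  have UC: "\<bar>U x\<bar> \<le> C" if "0 \<le> x" "x \<le> 1" for x
    by (rule LIMSEQ_le_const2[OF tendsto_rabs[OF lim[OF that]]]) (use bounded[OF that] in blast)
  show weak: "has_weak_deriv U s"
    unfolding has_weak_deriv_def
  proof (intro conjI ballI)
    show "U \<in> L2_fun" "s \<in> L2_fun"
      by (rule L2_fun_continuous[OF Uc], rule L2_fun_bounded[OF s B])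
    fix \<phi> assume \<phi>: "\<phi> \<in> test_fun"
    note [measurable] = test_fun_measurable[OF \<phi>]
    have "(\<lambda>n. LINT x|unit_meas. \<Phi> n x * deriv \<phi> x) \<longlonglongrightarrow> (LINT x|unit_meas. U x * deriv \<phi> x)"
    proof (rule LINT_dominated_unit[where w = "\<lambda>x. C * \<bar>deriv \<phi> x\<bar>"])
      show "integrable unit_meas (\<lambda>x. C * \<bar>deriv \<phi> x\<bar>)"
        using L2_fun_integrable[OF test_fun_L2(2)[OF \<phi>]] by auto
      show "\<bar>\<Phi> n x * deriv \<phi> x\<bar> \<le> C * \<bar>deriv \<phi> x\<bar>" if "0 < x" "x < 1" for n x
        using bounded[of x n] that by (simp add: abs_mult mult_right_mono)
      show "AE x in unit_meas. (\<lambda>n. \<Phi> n x * deriv \<phi> x) \<longlonglongrightarrow> U x * deriv \<phi> x"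
        by (intro AE_unitI tendsto_intros lim) auto
    qed measurable
    moreover have "(\<lambda>n. - (LINT x|unit_meas. deriv (\<Phi> n) x * \<phi> x)) \<longlonglongrightarrow> - (LINT x|unit_meas. s x * \<phi> x)"
    proof (rule tendsto_minus, rule LINT_dominated_unit[where w = "\<lambda>x. C * \<bar>\<phi> x\<bar>"])
      show "integrable unit_meas (\<lambda>x. C * \<bar>\<phi> x\<bar>)"
        using L2_fun_integrable[OF test_fun_L2(1)[OF \<phi>]] by auto
      show "\<bar>deriv (\<Phi> n) x * \<phi> x\<bar> \<le> C * \<bar>\<phi> x\<bar>" for n x
        using \<Phi>(2)[of n x] by (simp add: abs_mult mult_right_mono)
      show "AE x in unit_meas. (\<lambda>n. deriv (\<Phi> n) x * \<phi> x) \<longlonglongrightarrow> s x * \<phi> x"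
        using \<Phi>(3) by eventually_elim (intro tendsto_intros)
    qed measurable
    ultimately show "(LINT x|unit_meas. U x * deriv \<phi> x) = - (LINT x|unit_meas. s x * \<phi> x)"
      unfolding test_fun_by_parts[OF \<Phi>(1) \<phi>] by (rule LIMSEQ_unique)
  qed
  have sC: "AE x in unit_meas. \<bar>s x\<bar> \<le> C"
    using \<Phi>(3)
    by eventually_elim (rule LIMSEQ_le_const2[OF tendsto_rabs], assumption, use \<Phi>(2) in blast)
  have "(\<lambda>n. LINT x|unit_meas. (\<Phi> n x - U x)\<^sup>2) \<longlonglongrightarrow> (LINT x|unit_meas. (0::real)\<^sup>2)"
  proof (rule LINT_dominated_unit[where w = "\<lambda>x. (C + C)\<^sup>2"])
    show "\<bar>(\<Phi> n x - U x)\<^sup>2\<bar> \<le> (C + C)\<^sup>2" if "0 < x" "x < 1" for n x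
    proof -
      have "\<bar>\<Phi> n x - U x\<bar> \<le> C + C"
        using bounded[of x n] UC[of x] that by linarith
      from power_mono[OF this, of 2] show ?thesis by simp
    qed
    show "AE x in unit_meas. (\<lambda>n. (\<Phi> n x - U x)\<^sup>2) \<longlonglongrightarrow> (0::real)\<^sup>2"
      by (intro AE_unitI tendsto_intros LIM_zero lim) auto
  qed (simp_all add: integrable_unit_continuous)
  moreover have "(\<lambda>n. LINT x|unit_meas. (deriv (\<Phi> n) x - s x)\<^sup>2) \<longlonglongrightarrow> (LINT x|unit_meas. (0::real)\<^sup>2)"
  proof (rule LINT_dominated_unit[where w = "\<lambda>x. (C + B)\<^sup>2"])
    show "\<bar>(deriv (\<Phi> n) x - s x)\<^sup>2\<bar> \<le> (C + B)\<^sup>2" if "0 < x" "x < 1" for n x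
    proof -
      have "\<bar>deriv (\<Phi> n) x - s x\<bar> \<le> C + B"
        using \<Phi>(2)[of n x] B[of x] that by linarith
      from power_mono[OF this, of 2] show ?thesis by simp
    qed
    show "AE x in unit_meas. (\<lambda>n. (deriv (\<Phi> n) x - s x)\<^sup>2) \<longlonglongrightarrow> (0::real)\<^sup>2"
      using \<Phi>(3) by eventually_elim (intro tendsto_intros LIM_zero)
  qed (simp_all add: integrable_unit_continuous)
  ultimately have "(\<lambda>n. sqrt ((LINT x|unit_meas. (\<Phi> n x - U x)\<^sup>2) + (LINT x|unit_meas. (deriv (\<Phi> n) x - s x)\<^sup>2)))
      \<longlonglongrightarrow> sqrt ((LINT x|unit_meas. (0::real)\<^sup>2) + (LINT x|unit_meas. (0::real)\<^sup>2))"
    by (intro tendsto_intros)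
  then have "(\<lambda>n. H1_norm (\<lambda>x. \<Phi> n x - U x)) \<longlonglongrightarrow> 0"
    by (simp add: H1_norm_eq[OF has_weak_deriv_diff[OF test_fun_has_weak_deriv[OF \<Phi>(1)] weak]])
  then show "U \<in> H10"
    unfolding H10_def H1_def using weak Uc \<Phi>(1) by blast
qed

text \<open>\<open>H1_norm\<close> controls the L^1 distance of the derivatives, hence uniformly the
  distance between \<open>\<phi> n\<close> and the primitive \<open>K\<close> of the weak
  derivative; it also controls the L^2 distance between \<open>\<phi> n\<close> and
  \<open>u\<close>. Thus \<open>K\<close> and \<open>u\<close> coincide in L^2, and by continuity
  everywhere on the closed interval.\<close>

lemma H10_approx:
  assumes u: "u \<in> H10"
  obtains \<phi> :: "nat \<Rightarrow> real \<Rightarrow> real" where "\<forall>n. \<phi> n \<in> test_fun"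
    "(\<lambda>n. LINT x|unit_meas. \<bar>deriv (\<phi> n) x - weak_deriv u x\<bar>) \<longlonglongrightarrow> 0"
    "\<forall>x\<in>{0..1}. u x = primitive (weak_deriv u) x"
    "\<forall>n. \<forall>x\<in>{0..1}. \<bar>\<phi> n x - u x\<bar> \<le> (LINT y|unit_meas. \<bar>deriv (\<phi> n) y - weak_deriv u y\<bar>)"
proof -
  from u obtain g0 \<phi> where g0: "has_weak_deriv u g0" and uc: "continuous_on {0..1} u"
    and \<phi>: "\<And>n::nat. \<phi> n \<in> test_fun" and lim: "(\<lambda>n. H1_norm (\<lambda>x. \<phi> n x - u x)) \<longlonglongrightarrow> 0"
    unfolding H10_def H1_def by blast
  define g where "g = weak_deriv u"
  have g: "has_weak_deriv u g"
    unfolding g_def by (rule has_weak_deriv_weak_deriv(1)[OF g0])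
  note gL2 = has_weak_deriv_L2[OF g]
  define K where "K = primitive g"
  have Kc: "continuous_on {0..1} K"
    unfolding K_def by (rule primitive_continuous[OF L2_fun_integrable[OF gL2(2)]])
  define e where "e n = (LINT y|unit_meas. \<bar>deriv (\<phi> n) y - g y\<bar>)" for n
  define d where "d n = (LINT y|unit_meas. (\<phi> n y - u y)\<^sup>2)" for n
  define N where "N n = H1_norm (\<lambda>x. \<phi> n x - u x)" for n
  have dL2: "(\<lambda>y. deriv (\<phi> n) y - g y) \<in> L2_fun" for n
    by (intro L2_fun_diff test_fun_L2 \<phi> gL2)
  have N: "N n = sqrt (d n + (LINT y|unit_meas. (deriv (\<phi> n) y - g y)\<^sup>2))" for n
    unfolding N_def d_def
    by (rule H1_norm_eq[OF has_weak_deriv_diff[OF test_fun_has_weak_deriv[OF \<phi>] g]])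
  have pos: "0 \<le> d n" "0 \<le> (LINT y|unit_meas. (deriv (\<phi> n) y - g y)\<^sup>2)" "0 \<le> e n" for n
    unfolding d_def e_def by simp_all
  have N2: "(N n)\<^sup>2 = d n + (LINT y|unit_meas. (deriv (\<phi> n) y - g y)\<^sup>2)" for n
    unfolding N using pos by simp
  have e2: "(e n)\<^sup>2 \<le> (N n)\<^sup>2" "d n \<le> (N n)\<^sup>2" for n
    using LINT_abs_square_le[OF dL2] pos unfolding e_def N2 by (auto intro: order_trans add_increasing)
  have N0: "0 \<le> N n" for n unfolding N using pos by simp
  have eN: "e n \<le> N n" for n
    using e2(1) N0 by (rule power2_le_imp_le)
  have Nlim: "N \<longlonglongrightarrow> 0" using lim by (simp add: N_def[abs_def])
  have elim: "e \<longlonglongrightarrow> 0"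
    by (rule Lim_null_comparison[OF _ Nlim]) (use eN pos in auto)
  have K: "\<bar>\<phi> n x - K x\<bar> \<le> e n" if x: "0 \<le> x" "x \<le> 1" for n x
  proof -
    have "\<phi> n x - K x = primitive (\<lambda>y. deriv (\<phi> n) y - g y) x"
      unfolding K_def test_fun_primitive[OF \<phi> x]
      by (intro primitive_diff[symmetric] L2_fun_integrable test_fun_L2 \<phi> gL2)
    then show ?thesis
      unfolding e_def using abs_primitive_le[OF L2_fun_integrable[OF dL2]] by simp
  qed
  have sq_cont: "continuous_on {0..1} (\<lambda>x. (K x - u x)\<^sup>2)"
    by (intro continuous_intros Kc uc)
  \<comment> \<open>Split \<open>K x - u x\<close> at \<open>\<phi> n x\<close>: both
    \<open>(e n)\<^sup>2\<close> and \<open>d n\<close> are at most \<open>(N n)\<^sup>2\<close>,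
    which gives the factor 2 + 2.\<close>
  have "(LINT x|unit_meas. (K x - u x)\<^sup>2) \<le> 4 * (N n)\<^sup>2" for n
  proof -
    have "(LINT x|unit_meas. (K x - u x)\<^sup>2) \<le> (LINT x|unit_meas. 2 * (e n)\<^sup>2 + 2 * (\<phi> n x - u x)\<^sup>2)"
    proof (rule integral_mono)
      show "integrable unit_meas (\<lambda>x. (K x - u x)\<^sup>2)"
        by (rule integrable_unit_continuous[OF sq_cont])
      show "integrable unit_meas (\<lambda>x. 2 * (e n)\<^sup>2 + 2 * (\<phi> n x - u x)\<^sup>2)"
        by (intro integrable_unit_continuous continuous_intros uc test_fun_derivs(3)[OF \<phi>])
      fix x assume "x \<in> space unit_meas"
      then have "\<bar>\<phi> n x - K x\<bar> \<le> e n" using K by simp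
      from power_mono[OF this, of 2] have "(\<phi> n x - K x)\<^sup>2 \<le> (e n)\<^sup>2" by simp
      moreover have "(K x - u x)\<^sup>2 \<le> 2 * (\<phi> n x - K x)\<^sup>2 + 2 * (\<phi> n x - u x)\<^sup>2"
        using zero_le_power2[of "(\<phi> n x - K x) + (\<phi> n x - u x)"] by (simp add: power2_eq_square algebra_simps)
      ultimately show "(K x - u x)\<^sup>2 \<le> 2 * (e n)\<^sup>2 + 2 * (\<phi> n x - u x)\<^sup>2" by linarith
    qed
    also have "\<dots> = (LINT x|unit_meas. 2 * (e n)\<^sup>2) + (LINT x|unit_meas. 2 * (\<phi> n x - u x)\<^sup>2)"
      by (intro Bochner_Integration.integral_add integrable_unit_continuous continuous_intros uc test_fun_derivs(3)[OF \<phi>])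
    also have "\<dots> = 2 * (e n)\<^sup>2 + 2 * d n"
      unfolding LINT_const_unit by (simp add: d_def)
    also have "\<dots> \<le> 4 * (N n)\<^sup>2"
      using e2[of n] by linarith
    finally show ?thesis .
  qed
  moreover have "(\<lambda>n. 4 * (N n)\<^sup>2) \<longlonglongrightarrow> 4 * 0\<^sup>2"
    by (intro tendsto_intros Nlim)
  ultimately have "(LINT x|unit_meas. (K x - u x)\<^sup>2) \<le> 4 * 0\<^sup>2"
    by (meson LIMSEQ_le_const)
  then have "(LINT x|unit_meas. (K x - u x)\<^sup>2) = 0"
    by (intro antisym) auto
  then have "integral {0..1} (\<lambda>x. (K x - u x)\<^sup>2) = 0"
    using primitive_eq_integral(1)[OF integrable_unit_continuous[OF sq_cont], of 1] by (simp add: primitive_1)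
  moreover have "(\<lambda>x. (K x - u x)\<^sup>2) integrable_on {0..1}"
    by (rule integrable_continuous_real[OF sq_cont])
  \<comment> \<open>A continuous nonnegative function with integral zero vanishes at every point,
    not just almost everywhere.\<close>
  ultimately have "((\<lambda>x. (K x - u x)\<^sup>2) has_integral 0) (cbox 0 1)"
    by (metis cbox_interval integrable_integral)
  then have "(K x - u x)\<^sup>2 = 0" if "x \<in> {0..1}" for x
    using has_integral_0_cbox_imp_0[of 0 1 "\<lambda>x. (K x - u x)\<^sup>2" x] sq_cont that by simp
  then have Ku: "u x = K x" if "x \<in> {0..1}" for x
    using that by simp
  show thesis
  proof (rule that)
    show "\<forall>n. \<phi> n \<in> test_fun" using \<phi> by blast
    show "(\<lambda>n. LINT x|unit_meas. \<bar>deriv (\<phi> n) x - weak_deriv u x\<bar>) \<longlonglongrightarrow> 0"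
      using elim by (simp add: e_def[abs_def] g_def)
    show "\<forall>x\<in>{0..1}. u x = primitive (weak_deriv u) x"
      using Ku by (simp add: K_def g_def)
    show "\<forall>n. \<forall>x\<in>{0..1}. \<bar>\<phi> n x - u x\<bar> \<le> (LINT y|unit_meas. \<bar>deriv (\<phi> n) y - weak_deriv u y\<bar>)"
      using K Ku by (simp add: e_def g_def)
  qed
qed

section \<open>Reduction to a transmission problem\<close>

lemma H10_has_weak_deriv:
  assumes "u \<in> H10"
  shows "has_weak_deriv u (weak_deriv u)"
proof -
  obtain g where "has_weak_deriv u g"
    using assms unfolding H10_def H1_def by blast
  then show ?thesis by (rule has_weak_deriv_weak_deriv(1))
qed

lemma H10_continuous: "u \<in> H10 \<Longrightarrow> continuous_on {0..1} u"
  by (simp add: H10_def)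

lemma H10_primitive:
  assumes "u \<in> H10" "0 \<le> x" "x \<le> 1"
  shows "u x = primitive (weak_deriv u) x"
  by (rule H10_approx[OF assms(1)]) (use assms(2,3) in simp)

text \<open>Test functions vanish at both endpoints, and the last bound of \<open>H10_approx\<close>
  is uniform on the closed interval.\<close>

lemma H10_endpoints:
  assumes "u \<in> H10"
  shows "u 0 = 0" "u 1 = 0"
proof -
  obtain \<phi> :: "nat \<Rightarrow> real \<Rightarrow> real" where \<phi>: "\<forall>n. \<phi> n \<in> test_fun"
    "(\<lambda>n. LINT x|unit_meas. \<bar>deriv (\<phi> n) x - weak_deriv u x\<bar>) \<longlonglongrightarrow> 0"
    "\<forall>x\<in>{0..1}. u x = primitive (weak_deriv u) x"
    "\<forall>n. \<forall>x\<in>{0..1}. \<bar>\<phi> n x - u x\<bar> \<le> (LINT y|unit_meas. \<bar>deriv (\<phi> n) y - weak_deriv u y\<bar>)"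
    using H10_approx[OF assms] .
  have "\<phi> n 0 = 0" "\<phi> n 1 = 0" for n
    using \<phi>(1) test_fun_endpoints by blast+
  then have "\<bar>u x\<bar> \<le> (LINT y|unit_meas. \<bar>deriv (\<phi> n) y - weak_deriv u y\<bar>)" if "x \<in> {0, 1}" for n x
    using \<phi>(4)[rule_format, of x n] that by auto
  then have "\<bar>u x\<bar> \<le> 0" if "x \<in> {0, 1}" for x
    using that by (intro LIMSEQ_le_const[OF \<phi>(2)]) simp
  from this[of 0] this[of 1] show "u 0 = 0" "u 1 = 0" by simp_all
qed

text \<open>A continuous weight on the closed interval is bounded, so convergence in L^1 survives
  multiplication by it.\<close>

lemma LINT_mult_tendsto:
  fixes w :: "real \<Rightarrow> real"
  assumes w: "continuous_on {0..1} w" and f: "\<And>n. integrable unit_meas (f n)" "integrable unit_meas g"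
    and lim: "(\<lambda>n. LINT x|unit_meas. \<bar>f n x - g x\<bar>) \<longlonglongrightarrow> 0"
  shows "(\<lambda>n. LINT x|unit_meas. w x * f n x) \<longlonglongrightarrow> (LINT x|unit_meas. w x * g x)"
proof -
  have "bounded (w ` {0..1})"
    using w by (intro compact_imp_bounded compact_continuous_image) auto
  then obtain B where B: "\<And>x. x \<in> {0..1} \<Longrightarrow> \<bar>w x\<bar> \<le> B"
    unfolding bounded_iff real_norm_def by blast
  have wi: "integrable unit_meas (\<lambda>x. w x * h x)" if h: "integrable unit_meas h" for h
  proof (rule Bochner_Integration.integrable_bound)
    show "integrable unit_meas (\<lambda>x. B * h x)" using h by simp
    show "(\<lambda>x. w x * h x) \<in> borel_measurable unit_meas"
      using h measurable_unit_continuous[OF w] by measurable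
    show "AE x in unit_meas. norm (w x * h x) \<le> norm (B * h x)"
    proof (rule AE_unitI)
      fix x :: real assume "0 < x" "x < 1"
      then have "\<bar>w x\<bar> \<le> \<bar>B\<bar>" using B[of x] by simp
      then show "norm (w x * h x) \<le> norm (B * h x)"
        by (simp add: abs_mult mult_right_mono)
    qed
  qed
  have "(\<lambda>n. (LINT x|unit_meas. w x * f n x) - (LINT x|unit_meas. w x * g x)) \<longlonglongrightarrow> 0"
  proof (rule Lim_null_comparison[OF always_eventually, rule_format])
    fix n
    have "(LINT x|unit_meas. w x * f n x) - (LINT x|unit_meas. w x * g x) = (LINT x|unit_meas. w x * (f n x - g x))"
      unfolding right_diff_distrib by (intro Bochner_Integration.integral_diff[symmetric] wi f)
    also have "\<bar>\<dots>\<bar> \<le> (LINT x|unit_meas. \<bar>w x * (f n x - g x)\<bar>)"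
      by (rule integral_abs_bound)
    also have "\<dots> \<le> (LINT x|unit_meas. B * \<bar>f n x - g x\<bar>)"
      using B by (intro integral_mono integrable_abs wi integrable_mult_right Bochner_Integration.integrable_diff f)
        (auto simp: abs_mult intro!: mult_right_mono)
    also have "\<dots> = B * (LINT x|unit_meas. \<bar>f n x - g x\<bar>)" by simp
    finally show "norm ((LINT x|unit_meas. w x * f n x) - (LINT x|unit_meas. w x * g x))
        \<le> B * (LINT x|unit_meas. \<bar>f n x - g x\<bar>)" by simp
  next
    show "(\<lambda>n. B * (LINT x|unit_meas. \<bar>f n x - g x\<bar>)) \<longlonglongrightarrow> 0"
      using tendsto_mult_right_zero[OF lim] .
  qed
  then show ?thesis by (rule LIM_zero_cancel)
qed

text \<open>Moves the pairing with \<phi> onto its weak derivative. For test functions this is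
  ordinary integration by parts, and both sides pass to the limit because \<open>\<psi> n\<close>
  and its derivative converge in L^1.\<close>

lemma H10_by_parts:
  assumes \<phi>: "\<phi> \<in> H10" and U: "continuous_on {0..1} U"
  shows "(LINT x|unit_meas. U x * \<phi> x) = - (LINT x|unit_meas. primitive U x * weak_deriv \<phi> x)"
proof -
  obtain \<psi> :: "nat \<Rightarrow> real \<Rightarrow> real" where \<psi>: "\<forall>n. \<psi> n \<in> test_fun"
    "(\<lambda>n. LINT x|unit_meas. \<bar>deriv (\<psi> n) x - weak_deriv \<phi> x\<bar>) \<longlonglongrightarrow> 0"
    "\<forall>x\<in>{0..1}. \<phi> x = primitive (weak_deriv \<phi>) x"
    "\<forall>n. \<forall>x\<in>{0..1}. \<bar>\<psi> n x - \<phi> x\<bar> \<le> (LINT y|unit_meas. \<bar>deriv (\<psi> n) y - weak_deriv \<phi> y\<bar>)"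
    using H10_approx[OF \<phi>] .
  note \<psi>1 = \<psi>(1)[rule_format]
  note Vc = primitive_continuous[OF integrable_unit_continuous[OF U]]
  have "(\<lambda>n. LINT x|unit_meas. U x * \<psi> n x) \<longlonglongrightarrow> (LINT x|unit_meas. U x * \<phi> x)"
  proof (rule LINT_mult_tendsto[OF U])
    show \<psi>i: "integrable unit_meas (\<psi> n)" for n
      by (intro integrable_unit_continuous test_fun_derivs \<psi>1)
    show \<phi>i: "integrable unit_meas \<phi>"
      by (intro integrable_unit_continuous H10_continuous \<phi>)
    show "(\<lambda>n. LINT x|unit_meas. \<bar>\<psi> n x - \<phi> x\<bar>) \<longlonglongrightarrow> 0"
    proof (rule Lim_null_comparison[OF always_eventually \<psi>(2), rule_format])
      fix n
      let ?e = "LINT y|unit_meas. \<bar>deriv (\<psi> n) y - weak_deriv \<phi> y\<bar>"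
      have "(LINT x|unit_meas. \<bar>\<psi> n x - \<phi> x\<bar>) \<le> (LINT x|unit_meas. ?e)"
        using \<psi>(4) by (intro integral_mono integrable_abs Bochner_Integration.integrable_diff \<psi>i \<phi>i
            integrable_unit_continuous continuous_intros) auto
      then show "norm (LINT x|unit_meas. \<bar>\<psi> n x - \<phi> x\<bar>) \<le> ?e"
        unfolding LINT_const_unit by simp
    qed
  qed
  moreover have "(\<lambda>n. LINT x|unit_meas. U x * \<psi> n x) = (\<lambda>n. - (LINT x|unit_meas. primitive U x * deriv (\<psi> n) x))"
  proof -
    have "(primitive U has_real_derivative U x) (at x)" if "0 < x" "x < 1" for x
      using primitive_has_derivative[OF U, of x] at_within_interior[of x "{0..1}"] that by simp
    from LINT_test_fun_by_parts[OF \<psi>1 Vc U this] show ?thesis by (intro ext) simp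
  qed
  moreover have "(\<lambda>n. - (LINT x|unit_meas. primitive U x * deriv (\<psi> n) x))
      \<longlonglongrightarrow> - (LINT x|unit_meas. primitive U x * weak_deriv \<phi> x)"
    by (intro tendsto_minus LINT_mult_tendsto Vc \<psi>(2) L2_fun_integrable test_fun_L2 \<psi>1
        has_weak_deriv_L2(2)[OF H10_has_weak_deriv[OF \<phi>]])
  ultimately show ?thesis
    by (simp only: LIMSEQ_unique)
qed

text \<open>Tested with the primitive of \<open>sgn (h - m)\<close> minus its mean, where \<open>m\<close> is the mean of \<open>h\<close>.\<close>

lemma AE_const_of_H10:
  assumes h: "h \<in> L2_fun" and orth: "\<And>\<phi>. \<phi> \<in> H10 \<Longrightarrow> (LINT x|unit_meas. h x * weak_deriv \<phi> x) = 0"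
  shows "\<exists>c. AE x in unit_meas. h x = c"
proof -
  have hi: "integrable unit_meas h" by (rule L2_fun_integrable[OF h])
  have [measurable]: "h \<in> borel_measurable unit_meas" by (rule L2_fun_measurable[OF h])
  define m where "m = (LINT x|unit_meas. h x)"
  define s0 where "s0 x = sgn (h x - m)" for x
  define k where "k = (LINT x|unit_meas. s0 x)"
  \<comment> \<open>With mean zero the primitive of \<open>s\<close> vanishes at 1 as well as at 0,
    so it belongs to \<open>H10\<close>.\<close>
  define s where "s x = s0 x - k" for x
  have [measurable]: "s0 \<in> borel_measurable unit_meas"
    unfolding s0_def by measurable
  then have sm [measurable]: "s \<in> borel_measurable unit_meas"
    unfolding s_def by measurable
  have s0_le: "\<bar>s0 x\<bar> \<le> 1" for x
    by (simp add: s0_def abs_sgn_eq)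
  have s0L2: "s0 \<in> L2_fun"
    by (rule L2_fun_bounded[of _ 1]) (use s0_le in auto)
  have sB: "\<bar>s x\<bar> \<le> 1 + \<bar>k\<bar>" for x
    using s0_le[of x] unfolding s_def by linarith
  have cL2: "(\<lambda>_. c) \<in> L2_fun" for c
    by (rule L2_fun_continuous) simp
  have mean: "(LINT x|unit_meas. s x) = 0"
  proof -
    have "(LINT x|unit_meas. s x) = (LINT x|unit_meas. s0 x) - (LINT x|unit_meas. k)"
      unfolding s_def by (intro Bochner_Integration.integral_diff L2_fun_integrable s0L2 cL2)
    then show ?thesis unfolding LINT_const_unit k_def by simp
  qed
  note p = H10_of_primitive[OF sm sB mean refl]
  have "AE x in unit_meas. weak_deriv (primitive s) x = s x"
    by (rule has_weak_deriv_weak_deriv(2)[OF p(1)])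
  moreover have [measurable]: "weak_deriv (primitive s) \<in> borel_measurable unit_meas"
    by (rule L2_fun_measurable[OF has_weak_deriv_L2(2)[OF H10_has_weak_deriv[OF p(2)]]])
  ultimately have "(LINT x|unit_meas. h x * weak_deriv (primitive s) x) = (LINT x|unit_meas. h x * s x)"
    by (intro integral_cong_AE) auto
  then have "(LINT x|unit_meas. h x * s x) = 0"
    using orth[OF p(2)] by simp
  moreover have "(LINT x|unit_meas. h x * s x) = (LINT x|unit_meas. h x * s0 x) - m * k"
  proof -
    have "(LINT x|unit_meas. h x * s x) = (LINT x|unit_meas. h x * s0 x) - (LINT x|unit_meas. h x * k)"
      unfolding s_def right_diff_distrib
      by (intro Bochner_Integration.integral_diff L2_fun_integrable_mult h s0L2 cL2)
    then show ?thesis by (simp add: m_def)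
  qed
  \<comment> \<open>Since |h - m| is (h - m) times its sign, this is the integral of
    \<open>h x * s x\<close> again, hence zero.\<close>
  moreover have "(LINT x|unit_meas. \<bar>h x - m\<bar>) = (LINT x|unit_meas. h x * s0 x) - m * k"
  proof -
    have "(LINT x|unit_meas. \<bar>h x - m\<bar>) = (LINT x|unit_meas. h x * s0 x - m * s0 x)"
      by (simp add: s0_def abs_sgn left_diff_distrib[symmetric])
    also have "\<dots> = (LINT x|unit_meas. h x * s0 x) - (LINT x|unit_meas. m * s0 x)"
      by (intro Bochner_Integration.integral_diff L2_fun_integrable_mult h s0L2 cL2)
    finally show ?thesis by (simp add: k_def)
  qed
  ultimately have "(LINT x|unit_meas. \<bar>h x - m\<bar>) = 0" by simp
  moreover have "integrable unit_meas (\<lambda>x. \<bar>h x - m\<bar>)"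
    by (intro integrable_abs L2_fun_integrable L2_fun_diff h cL2)
  ultimately have "AE x in unit_meas. \<bar>h x - m\<bar> = 0"
    using integral_nonneg_eq_0_iff_AE[of unit_meas "\<lambda>x. \<bar>h x - m\<bar>"] by simp
  then show ?thesis by auto
qed

lemma indicator_L2: "indicat_real {..a} \<in> L2_fun"
  by (rule L2_fun_bounded[of _ 1, OF measurable_unit_borel]) (auto simp: indicator_def)

text \<open>All three terms of the weak equation become integrals against the weak derivative of the
  test element, and \<open>h\<close> collects their factors. Orthogonality to all such derivatives
  forces \<open>h\<close> to be constant; conversely a constant is orthogonal to them because
  elements of \<open>H10\<close> vanish at both ends.\<close>

lemma is_solution_iff_AE:
  "is_solution lam U \<longleftrightarrow> U \<in> H10 \<and>
    (\<exists>c. AE x in unit_meas. weak_deriv U x = c + 8 * U (1/2) * indicat_real {..1/2} x - lam * primitive U x)"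
proof (cases "U \<in> H10")
  case U: True
  note Uc = H10_continuous[OF U]
  note Vc = primitive_continuous[OF integrable_unit_continuous[OF Uc]]
  define h where "h x = (weak_deriv U x - 8 * U (1/2) * indicat_real {..1/2} x) - (- lam) * primitive U x" for x
  have wU: "weak_deriv U \<in> L2_fun"
    by (rule has_weak_deriv_L2(2)[OF H10_has_weak_deriv[OF U]])
  have L2_cmult: "(\<lambda>x. c * f x) \<in> L2_fun" if "f \<in> L2_fun" for c f
    using that by (auto simp: L2_fun_def power_mult_distrib)
  have i1: "(\<lambda>x. 8 * U (1/2) * indicat_real {..1/2} x) \<in> L2_fun"
    by (intro L2_cmult indicator_L2)
  have i2: "(\<lambda>x. (- lam) * primitive U x) \<in> L2_fun"
    by (intro L2_cmult L2_fun_continuous Vc)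
  have hL2: "h \<in> L2_fun"
    unfolding h_def by (intro L2_fun_diff wU i1 i2)
  have weak_form: "- second_deriv U \<phi> - 8 * delta_half U \<phi> - lam * L2_functional U \<phi>
      = (LINT x|unit_meas. h x * weak_deriv \<phi> x)" if \<phi>: "\<phi> \<in> H10" for \<phi>
  proof -
    have w: "weak_deriv \<phi> \<in> L2_fun"
      by (rule has_weak_deriv_L2(2)[OF H10_has_weak_deriv[OF \<phi>]])
    have "(LINT x|unit_meas. h x * weak_deriv \<phi> x) =
        (LINT x|unit_meas. (weak_deriv U x - 8 * U (1/2) * indicat_real {..1/2} x) * weak_deriv \<phi> x) -
        (LINT x|unit_meas. (- lam) * primitive U x * weak_deriv \<phi> x)"
      unfolding h_def left_diff_distrib[of _ "- lam * _"]
      by (intro Bochner_Integration.integral_diff L2_fun_integrable_mult L2_fun_diff wU i1 i2 w)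
    also have "(LINT x|unit_meas. (weak_deriv U x - 8 * U (1/2) * indicat_real {..1/2} x) * weak_deriv \<phi> x)
        = (LINT x|unit_meas. weak_deriv U x * weak_deriv \<phi> x) -
          (LINT x|unit_meas. 8 * U (1/2) * indicat_real {..1/2} x * weak_deriv \<phi> x)"
      unfolding left_diff_distrib
      by (intro Bochner_Integration.integral_diff L2_fun_integrable_mult wU i1 w)
    \<comment> \<open>The value at 1/2 is the integral of the weak derivative up to 1/2, which turns
      the point interaction into an indicator.\<close>
    also have "(LINT x|unit_meas. 8 * U (1/2) * indicat_real {..1/2} x * weak_deriv \<phi> x) = 8 * U (1/2) * \<phi> (1/2)"
      using H10_primitive[OF \<phi>, of "1/2"] by (simp add: primitive_def mult.assoc)
    also have "(LINT x|unit_meas. (- lam) * primitive U x * weak_deriv \<phi> x) = lam * L2_functional U \<phi>"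
      using H10_by_parts[OF \<phi> Uc] by (simp add: L2_functional_def mult.assoc)
    finally show ?thesis
      by (simp add: second_deriv_def delta_half_def)
  qed
  have "is_solution lam U \<longleftrightarrow> (\<forall>\<phi>\<in>H10. (LINT x|unit_meas. h x * weak_deriv \<phi> x) = 0)"
    unfolding is_solution_def using U weak_form by (auto simp: algebra_simps)
  also have "\<dots> \<longleftrightarrow> (\<exists>c. AE x in unit_meas. h x = c)"
  proof
    assume "\<forall>\<phi>\<in>H10. (LINT x|unit_meas. h x * weak_deriv \<phi> x) = 0"
    then show "\<exists>c. AE x in unit_meas. h x = c"
      by (intro AE_const_of_H10[OF hL2]) auto
  next
    assume "\<exists>c. AE x in unit_meas. h x = c"
    then obtain c where c: "AE x in unit_meas. h x = c" by blast
    show "\<forall>\<phi>\<in>H10. (LINT x|unit_meas. h x * weak_deriv \<phi> x) = 0"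
    proof
      fix \<phi> assume \<phi>: "\<phi> \<in> H10"
      have [measurable]: "weak_deriv \<phi> \<in> borel_measurable unit_meas" "h \<in> borel_measurable unit_meas"
        by (rule L2_fun_measurable[OF has_weak_deriv_L2(2)[OF H10_has_weak_deriv[OF \<phi>]]])
          (rule L2_fun_measurable[OF hL2])
      have "(LINT x|unit_meas. h x * weak_deriv \<phi> x) = (LINT x|unit_meas. c * weak_deriv \<phi> x)"
        by (rule integral_cong_AE) (use c in auto)
      also have "\<dots> = c * (LINT x|unit_meas. weak_deriv \<phi> x)" by simp
      also have "(LINT x|unit_meas. weak_deriv \<phi> x) = 0"
        using H10_primitive[OF \<phi>, of 1] H10_endpoints(2)[OF \<phi>] by (simp add: primitive_1)
      finally show "(LINT x|unit_meas. h x * weak_deriv \<phi> x) = 0" by simp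
    qed
  qed
  also have "\<dots> \<longleftrightarrow> (\<exists>c. AE x in unit_meas. weak_deriv U x = c + 8 * U (1/2) * indicat_real {..1/2} x - lam * primitive U x)"
    by (simp add: h_def algebra_simps)
  finally show ?thesis using U by simp
qed (simp add: is_solution_def)

text \<open>\<open>P\<close> is the slope of \<open>U\<close>, giving a first-order system.
  Derivatives are taken within \<open>I\<close>, hence one-sided at 1/2, where each half has its own
  slope.\<close>

definition solves_on :: "real \<Rightarrow> real set \<Rightarrow> (real \<Rightarrow> real) \<Rightarrow> (real \<Rightarrow> real) \<Rightarrow> bool" where
  "solves_on lam I U P \<longleftrightarrow> (\<forall>x\<in>I. (U has_real_derivative P x) (at x within I) \<and>
     (P has_real_derivative - lam * U x) (at x within I))"

text \<open>Read on each half, the right-hand side of the almost-everywhere equation is a continuous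
  function; these are \<open>P1\<close> and \<open>P2\<close>. They differ by the coefficient of the
  indicator, which is the jump.\<close>

lemma is_solution_imp_ode:
  assumes "is_solution lam U"
  obtains P1 P2 where "U 0 = 0" "U 1 = 0" "solves_on lam {0..1/2} U P1" "solves_on lam {1/2..1} U P2"
    "P1 (1/2) - P2 (1/2) = 8 * U (1/2)"
proof -
  obtain c where U: "U \<in> H10" and
    c: "AE x in unit_meas. weak_deriv U x = c + 8 * U (1/2) * indicat_real {..1/2} x - lam * primitive U x"
    using assms unfolding is_solution_iff_AE by (elim conjE exE)
  note Uc = H10_continuous[OF U]
  note Vc = primitive_continuous[OF integrable_unit_continuous[OF Uc]]
  define V where "V = primitive U"
  define s where "s x = c + 8 * U (1/2) * indicat_real {..1/2} x - lam * V x" for x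
  define P1 where "P1 x = c + 8 * U (1/2) - lam * V x" for x
  define P2 where "P2 x = c - lam * V x" for x
  have Pc: "continuous_on {0..1} P1" "continuous_on {0..1} P2"
    unfolding P1_def P2_def V_def by (intro continuous_intros Vc)+
  have [measurable]: "V \<in> borel_measurable unit_meas" "indicat_real {..1/2} \<in> borel_measurable unit_meas"
    unfolding V_def by (rule measurable_unit_continuous[OF Vc], rule measurable_unit_borel) simp
  have "s \<in> borel_measurable unit_meas"
    unfolding s_def by measurable
  \<comment> \<open>The weak derivative may be replaced by the explicit \<open>s\<close>, since
    primitives ignore null sets.\<close>
  then have Us: "U x = primitive s x" if "0 \<le> x" "x \<le> 1" for x
    unfolding H10_primitive[OF U that]
    by (intro primitive_cong_AE[OF _ L2_fun_measurable[OF has_weak_deriv_L2(2)[OF H10_has_weak_deriv[OF U]]]])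
      (use c in \<open>simp_all only: s_def V_def\<close>)
  have left: "primitive s x = primitive P1 x" if "x \<le> 1/2" for x
    unfolding primitive_def
    by (rule Bochner_Integration.integral_cong) (use that in \<open>auto simp: s_def P1_def indicator_def\<close>)
  \<comment> \<open>Beyond 1/2 the indicator term contributes this fixed amount, which disappears on
    differentiation.\<close>
  define K where "K = (LINT y|unit_meas. 8 * U (1/2) * indicat_real {..1/2} y)"
  have right: "primitive s x = primitive P2 x + K"
    if "1/2 \<le> x" for x
  proof -
    have "primitive s x = (LINT y|unit_meas. indicat_real {..x} y * P2 y + 8 * U (1/2) * indicat_real {..1/2} y)"
      unfolding primitive_def
      by (rule Bochner_Integration.integral_cong) (use that in \<open>auto simp: s_def P2_def indicator_def\<close>)
    also have "\<dots> = primitive P2 x + K"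
      unfolding primitive_def K_def
      by (intro Bochner_Integration.integral_add integrable_indicator_times integrable_unit_continuous Pc
          integrable_mult_right L2_fun_integrable indicator_L2)
    finally show ?thesis .
  qed
  have Vd: "(V has_real_derivative U x) (at x within {0..1})" if "0 \<le> x" "x \<le> 1" for x
    unfolding V_def by (rule primitive_has_derivative[OF Uc that])
  have Pd: "(P1 has_real_derivative - lam * U x) (at x within {0..1})"
    "(P2 has_real_derivative - lam * U x) (at x within {0..1})" if "0 \<le> x" "x \<le> 1" for x
    unfolding P1_def[abs_def] P2_def[abs_def]
    by (rule derivative_eq_intros Vd[OF that] refl | simp)+
  show thesis
  proof (rule that[of P1 P2])
    show "U 0 = 0" "U 1 = 0" by (rule H10_endpoints[OF U])+
    show "P1 (1/2) - P2 (1/2) = 8 * U (1/2)" by (simp add: P1_def P2_def)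
    show "solves_on lam {0..1/2} U P1"
      unfolding solves_on_def
    proof (intro ballI conjI)
      fix x :: real assume x: "x \<in> {0..1/2}"
      have "(primitive P1 has_real_derivative P1 x) (at x within {0..1/2})"
        by (rule DERIV_subset[OF primitive_has_derivative[OF Pc(1)]]) (use x in auto)
      then show "(U has_real_derivative P1 x) (at x within {0..1/2})"
        by (rule has_field_derivative_transform_within[where d = 1]) (use x Us left in auto)
      show "(P1 has_real_derivative - lam * U x) (at x within {0..1/2})"
        by (rule DERIV_subset[OF Pd(1)]) (use x in auto)
    qed
    show "solves_on lam {1/2..1} U P2"
      unfolding solves_on_def
    proof (intro ballI conjI)
      fix x :: real assume x: "x \<in> {1/2..1}"
      have "((\<lambda>x. primitive P2 x + K)
          has_real_derivative P2 x + 0) (at x within {1/2..1})"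
        by (intro DERIV_add DERIV_const DERIV_subset[OF primitive_has_derivative[OF Pc(2)]]) (use x in auto)
      then have "((\<lambda>x. primitive P2 x + K)
          has_real_derivative P2 x) (at x within {1/2..1})"
        by (simp only: add_0_right)
      then show "(U has_real_derivative P2 x) (at x within {1/2..1})"
        by (rule has_field_derivative_transform_within[where d = 1]) (use x Us right in auto)
      show "(P2 has_real_derivative - lam * U x) (at x within {1/2..1})"
        by (rule DERIV_subset[OF Pd(2)]) (use x in auto)
    qed
  qed
qed

text \<open>On each half, slope plus \<open>lam\<close> times the primitive of \<open>U\<close> is
  constant. The jump condition makes the two constants differ by \<open>8 * U (1/2)\<close>, so off
  1/2 the derivative of \<open>U\<close> is the single formula \<open>s\<close>. This is bounded,
  and has mean zero by the boundary conditions, so \<open>U\<close> lies in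
  \<open>H10\<close>.\<close>

lemma is_solution_of_ode:
  assumes U01: "U 0 = 0" "U 1 = 0"
    and ode: "solves_on lam {0..1/2} U P1" "solves_on lam {1/2..1} U P2"
    and jump: "P1 (1/2) - P2 (1/2) = 8 * U (1/2)"
  shows "is_solution lam U"
proof -
  have Ud: "(U has_real_derivative P1 x) (at x within {0..1/2})"
    "(P1 has_real_derivative - lam * U x) (at x within {0..1/2})" if "x \<in> {0..1/2}" for x
    using ode(1) that by (simp_all add: solves_on_def)
  have Ud': "(U has_real_derivative P2 x) (at x within {1/2..1})"
    "(P2 has_real_derivative - lam * U x) (at x within {1/2..1})" if "x \<in> {1/2..1}" for x
    using ode(2) that by (simp_all add: solves_on_def)
  have "continuous_on ({0..1/2} \<union> {1/2..1}) U"
    by (intro continuous_on_closed_Un DERIV_continuous_on[OF Ud(1)] DERIV_continuous_on[OF Ud'(1)]) simp_all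
  also have "{0..1/2} \<union> {1/2..1} = {0..1::real}" by auto
  finally have Uc: "continuous_on {0..1} U" .
  note Vc = primitive_continuous[OF integrable_unit_continuous[OF Uc]]
  define V where "V = primitive U"
  \<comment> \<open>Evaluation at 0 determines this constant: \<open>V\<close> vanishes and the
    indicator is 1 there.\<close>
  define c where "c = P1 0 - 8 * U (1/2)"
  define s where "s x = c + 8 * U (1/2) * indicat_real {..1/2} x - lam * V x" for x
  have Vd: "(V has_real_derivative U x) (at x within {0..1})" if "0 \<le> x" "x \<le> 1" for x
    unfolding V_def by (rule primitive_has_derivative[OF Uc that])
  have V0: "V 0 = 0" by (simp add: V_def primitive_0)
  have "\<exists>k. \<forall>x\<in>{0..1/2}. P1 x + lam * V x = k"
  proof (rule has_field_derivative_zero_constant)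
    fix x :: real assume x: "x \<in> {0..1/2}"
    have "(V has_real_derivative U x) (at x within {0..1/2})"
      by (rule DERIV_subset[OF Vd]) (use x in auto)
    then show "((\<lambda>x. P1 x + lam * V x) has_real_derivative 0) (at x within {0..1/2})"
      using Ud(2)[OF x] by (auto intro!: derivative_eq_intros)
  qed simp
  then obtain k where k: "\<And>x. x \<in> {0..1/2} \<Longrightarrow> P1 x + lam * V x = k" by blast
  have P1: "P1 x = s x" if "x \<in> {0..1/2}" for x
    using k[OF that] k[of 0] that V0 by (simp add: s_def c_def)
  have "\<exists>k. \<forall>x\<in>{1/2..1}. P2 x + lam * V x = k"
  proof (rule has_field_derivative_zero_constant)
    fix x :: real assume x: "x \<in> {1/2..1}"
    have "(V has_real_derivative U x) (at x within {1/2..1})"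
      by (rule DERIV_subset[OF Vd]) (use x in auto)
    then show "((\<lambda>x. P2 x + lam * V x) has_real_derivative 0) (at x within {1/2..1})"
      using Ud'(2)[OF x] by (auto intro!: derivative_eq_intros)
  qed simp
  then obtain k' where k': "\<And>x. x \<in> {1/2..1} \<Longrightarrow> P2 x + lam * V x = k'" by blast
  have P2: "P2 x = s x" if "x \<in> {1/2<..1}" for x
    using k'[of x] k'[of "1/2"] k[of 0] k[of "1/2"] that V0 jump by (simp add: s_def c_def)
  have [measurable]: "V \<in> borel_measurable unit_meas" "indicat_real {..1/2} \<in> borel_measurable unit_meas"
    unfolding V_def by (rule measurable_unit_continuous[OF Vc], rule measurable_unit_borel) simp
  have sm: "s \<in> borel_measurable unit_meas"
    unfolding s_def by measurable
  have "bounded (V ` {0..1})"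
    using Vc unfolding V_def by (intro compact_imp_bounded compact_continuous_image) auto
  then obtain B where B: "\<And>x. x \<in> {0..1} \<Longrightarrow> \<bar>V x\<bar> \<le> B"
    unfolding bounded_iff real_norm_def by blast
  have sB: "\<bar>s x\<bar> \<le> \<bar>c\<bar> + \<bar>8 * U (1/2)\<bar> + \<bar>lam\<bar> * B" if "0 < x" "x < 1" for x
  proof -
    have "\<bar>lam * V x\<bar> \<le> \<bar>lam\<bar> * B"
      using B[of x] that by (simp add: abs_mult mult_left_mono)
    moreover have "\<bar>8 * U (1/2) * indicat_real {..1/2} x\<bar> \<le> \<bar>8 * U (1/2)\<bar>"
      by (simp add: indicator_def)
    ultimately show ?thesis unfolding s_def by linarith
  qed
  have Us: "U x = primitive s x" if x: "0 \<le> x" "x \<le> 1" for x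
  proof -
    have "primitive s x = U x - U 0"
    proof (rule primitive_of_derivative[where S = "{1/2}"])
      show "integrable unit_meas s" by (rule integrable_unit_bounded[OF sm sB])
      fix y :: real assume y: "0 < y" "y < 1" "y \<notin> {1/2}"
      show "(U has_real_derivative s y) (at y)"
      proof (cases "y < 1/2")
        case True
        then show ?thesis
          using Ud(1)[of y] P1[of y] y at_within_interior[of y "{0..1/2}"] by simp
      next
        case False
        then show ?thesis
          using Ud'(1)[of y] P2[of y] y at_within_interior[of y "{1/2..1}"] by simp
      qed
    qed (use Uc x in auto)
    then show ?thesis using U01 by simp
  qed
  have mean: "(LINT x|unit_meas. s x) = 0"
    using Us[of 1] U01 by (simp add: primitive_1)
  note p = H10_of_primitive[OF sm sB mean Us]
  have "AE x in unit_meas. weak_deriv U x = c + 8 * U (1/2) * indicat_real {..1/2} x - lam * primitive U x"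
    using has_weak_deriv_weak_deriv(2)[OF p(1)] by (simp add: s_def V_def)
  then show ?thesis
    unfolding is_solution_iff_AE by (intro conjI p(2) exI)
qed

section \<open>The characteristic equation\<close>

text \<open>The expression is the Wronskian of \<open>S\<close> and \<open>C\<close>. It unites the
  identities for sin^2 + cos^2 and cosh^2 - sinh^2, whatever the sign of \<open>lam\<close>.\<close>

lemma fundamental_solution_invariant:
  assumes "\<And>x. (S has_real_derivative C x) (at x)" "\<And>x. (C has_real_derivative - lam * S x) (at x)"
    and "S 0 = 0" "C 0 = 1"
  shows "(C x)\<^sup>2 + lam * (S x)\<^sup>2 = 1"
proof -
  have "((\<lambda>x. (C x)\<^sup>2 + lam * (S x)\<^sup>2) has_real_derivative 0) (at x)" for x
    by (rule derivative_eq_intros assms refl)+ (simp add: algebra_simps)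
  then have "(C x)\<^sup>2 + lam * (S x)\<^sup>2 = (C 0)\<^sup>2 + lam * (S 0)\<^sup>2"
    by (intro DERIV_isconst_all) auto
  then show ?thesis using assms by simp
qed

text \<open>The Wronskians of \<open>U\<close> with \<open>S\<close> and with \<open>C\<close> are
  constant, with values 0 and \<open>P 0\<close>. They are two linear equations for
  \<open>U x\<close> and \<open>P x\<close> whose determinant is the invariant 1.\<close>

lemma solves_on_unique:
  assumes SC: "\<And>x. (S has_real_derivative C x) (at x)" "\<And>x. (C has_real_derivative - lam * S x) (at x)"
    "S 0 = 0" "C 0 = 1"
    and ode: "solves_on lam {0..b} U P" and U0: "U 0 = 0" and x: "x \<in> {0..b}"
  shows "U x = P 0 * S x" "P x = P 0 * C x"
proof -
  have d: "(U has_real_derivative P x) (at x within {0..b})"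
    "(P has_real_derivative - lam * U x) (at x within {0..b})"
    "(S has_real_derivative C x) (at x within {0..b})"
    "(C has_real_derivative - lam * S x) (at x within {0..b})" if "x \<in> {0..b}" for x
    using ode that has_field_derivative_at_within[OF SC(1)] has_field_derivative_at_within[OF SC(2)]
    unfolding solves_on_def by blast+
  have "\<exists>k. \<forall>x\<in>{0..b}. U x * C x - P x * S x = k"
  proof (rule has_field_derivative_zero_constant)
    fix x assume x: "x \<in> {0..b}"
    show "((\<lambda>x. U x * C x - P x * S x) has_real_derivative 0) (at x within {0..b})"
      by (rule derivative_eq_intros d[OF x] refl)+ (simp add: algebra_simps)
  qed simp
  then obtain k where "\<And>x. x \<in> {0..b} \<Longrightarrow> U x * C x - P x * S x = k" by blast
  from this[of 0] this[of x] have 1: "U x * C x - P x * S x = 0"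
    using x U0 SC(3) by simp
  have "\<exists>k. \<forall>x\<in>{0..b}. P x * C x + lam * (U x * S x) = k"
  proof (rule has_field_derivative_zero_constant)
    fix x assume x: "x \<in> {0..b}"
    show "((\<lambda>x. P x * C x + lam * (U x * S x)) has_real_derivative 0) (at x within {0..b})"
      by (rule derivative_eq_intros d[OF x] refl)+ (simp add: algebra_simps)
  qed simp
  then obtain k where "\<And>x. x \<in> {0..b} \<Longrightarrow> P x * C x + lam * (U x * S x) = k" by blast
  from this[of 0] this[of x] have 2: "P x * C x + lam * (U x * S x) = P 0"
    using x U0 SC(4) by simp
  have inv: "(C x)\<^sup>2 + lam * (S x)\<^sup>2 = 1"
    by (rule fundamental_solution_invariant[OF SC])
  have "U x = U x * ((C x)\<^sup>2 + lam * (S x)\<^sup>2)"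
    using inv by simp
  also have "\<dots> = C x * (U x * C x - P x * S x) + S x * (P x * C x + lam * (U x * S x))"
    by (simp add: power2_eq_square algebra_simps)
  finally show "U x = P 0 * S x"
    by (simp add: 1 2)
  have "P x = P x * ((C x)\<^sup>2 + lam * (S x)\<^sup>2)"
    using inv by simp
  also have "\<dots> = C x * (P x * C x + lam * (U x * S x)) - lam * S x * (U x * C x - P x * S x)"
    by (simp add: power2_eq_square algebra_simps)
  finally show "P x = P 0 * C x"
    by (simp add: 1 2)
qed

text \<open>The equation is invariant under reflection at 1/2, the slope changing sign; this carries
  uniqueness from the left end over to the right end.\<close>

lemma solves_on_reflect:
  assumes "solves_on lam {1/2..1} U P"
  shows "solves_on lam {0..1/2} (\<lambda>x. U (1 - x)) (\<lambda>x. - P (1 - x))"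
  unfolding solves_on_def
proof (intro ballI conjI)
  fix x :: real assume x: "x \<in> {0..1/2}"
  have img: "(\<lambda>x. 1 - x) ` {0..1/2} = {1/2..1::real}"
    by simp
  have r: "((\<lambda>x. 1 - x) has_real_derivative - 1) (at x within {0..1/2})"
    by (auto intro!: derivative_eq_intros)
  have d: "(U has_real_derivative P (1 - x)) (at (1 - x) within (\<lambda>x. 1 - x) ` {0..1/2})"
    "(P has_real_derivative - lam * U (1 - x)) (at (1 - x) within (\<lambda>x. 1 - x) ` {0..1/2})"
    using assms x unfolding img solves_on_def by simp_all
  show "((\<lambda>x. U (1 - x)) has_real_derivative - P (1 - x)) (at x within {0..1/2})"
    using DERIV_image_chain[OF d(1) r] by (simp add: o_def)
  show "((\<lambda>x. - P (1 - x)) has_real_derivative - lam * U (1 - x)) (at x within {0..1/2})"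
    using DERIV_minus[OF DERIV_image_chain[OF d(2) r]] by (simp add: o_def)
qed

text \<open>A solution is a S(x) on the left and b S(1 - x) on the right. At the midpoint continuity
  reads a S = b S and the jump reads (a + b) C = 8 a S. A nonzero pair (a, b) exists iff S = 0, or a
  = b and C = 4 S. Keeping \<open>S\<close> and \<open>C\<close> abstract serves all signs of
  \<open>lam\<close> at once.\<close>

lemma is_eigenvalue_iff:
  assumes SC: "\<And>x. (S has_real_derivative C x) (at x)" "\<And>x. (C has_real_derivative - lam * S x) (at x)"
    "S 0 = 0" "C 0 = 1"
  shows "is_eigenvalue lam \<longleftrightarrow> S (1/2) * (C (1/2) - 4 * S (1/2)) = 0"
proof
  assume "is_eigenvalue lam"
  then obtain U x where sol: "is_solution lam U" and x: "x \<in> {0..1}" "U x \<noteq> 0"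
    unfolding is_eigenvalue_def by blast
  obtain P1 P2 where U: "U 0 = 0" "U 1 = 0" "solves_on lam {0..1/2} U P1" "solves_on lam {1/2..1} U P2"
    "P1 (1/2) - P2 (1/2) = 8 * U (1/2)"
    using is_solution_imp_ode[OF sol] .
  define a where "a = P1 0"
  define b where "b = - P2 1"
  have left: "U y = a * S y" "P1 y = a * C y" if "y \<in> {0..1/2}" for y
    using solves_on_unique[OF SC U(3,1) that] by (simp_all add: a_def)
  have right: "U (1 - y) = b * S y" "- P2 (1 - y) = b * C y" if "y \<in> {0..1/2}" for y
    using solves_on_unique[OF SC solves_on_reflect[OF U(4)] _ that] U(2) by (simp_all add: b_def)
  have "a \<noteq> 0 \<or> b \<noteq> 0"
    using left(1)[of x] right(1)[of "1 - x"] x by (cases "x \<le> 1/2") auto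
  moreover have "a * S (1/2) = b * S (1/2)" "(a + b) * C (1/2) = 8 * a * S (1/2)"
    using left[of "1/2"] right[of "1/2"] U(5) by (simp_all add: algebra_simps)
  ultimately show "S (1/2) * (C (1/2) - 4 * S (1/2)) = 0"
    by (cases "S (1/2) = 0") auto
next
  assume "S (1/2) * (C (1/2) - 4 * S (1/2)) = 0"
  \<comment> \<open>The eigenfunction is odd about the midpoint, b = -1, if S(1/2) = 0, and even, b
    = 1, otherwise.\<close>
  then have "\<exists>b. S (1/2) = b * S (1/2) \<and> (1 + b) * C (1/2) = 8 * S (1/2)"
  proof (cases "S (1/2) = 0")
    case True
    then show ?thesis by (intro exI[of _ "-1"]) simp
  next
    case False
    with \<open>S (1/2) * (C (1/2) - 4 * S (1/2)) = 0\<close> show ?thesis by (intro exI[of _ 1]) simp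
  qed
  then obtain b where b: "S (1/2) = b * S (1/2)" "(1 + b) * C (1/2) = 8 * S (1/2)" by blast
  define U where "U x = (if x \<le> 1/2 then S x else b * S (1 - x))" for x
  have U_left: "U x = S x" if "x \<in> {0..1/2}" for x
    using that by (simp add: U_def)
  have U_right: "U x = b * S (1 - x)" if "x \<in> {1/2..1}" for x
  proof (cases "x = 1/2")
    case True
    then show ?thesis using b(1) by (simp only: U_def) simp
  qed (use that in \<open>simp add: U_def\<close>)
  have r: "((\<lambda>x. 1 - x) has_real_derivative - 1) (at x)" for x :: real
    by (auto intro!: derivative_eq_intros)
  have "is_solution lam U"
  proof (rule is_solution_of_ode)
    show "U 0 = 0" "U 1 = 0" using SC(3) by (simp_all add: U_def)
    show "C (1/2) - (- b * C (1 - 1/2)) = 8 * U (1/2)"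
      using b(2) by (simp add: U_def algebra_simps)
    show "solves_on lam {0..1/2} U C"
      unfolding solves_on_def
    proof (intro ballI conjI)
      fix x :: real assume x: "x \<in> {0..1/2}"
      show "(U has_real_derivative C x) (at x within {0..1/2})"
        by (rule has_field_derivative_transform_within[OF has_field_derivative_at_within[OF SC(1)], of 1])
          (use x U_left in auto)
      show "(C has_real_derivative - lam * U x) (at x within {0..1/2})"
        using has_field_derivative_at_within[OF SC(2)[of x]] U_left[OF x] by simp
    qed
    show "solves_on lam {1/2..1} U (\<lambda>x. - b * C (1 - x))"
      unfolding solves_on_def
    proof (intro ballI conjI)
      fix x :: real assume x: "x \<in> {1/2..1}"
      have "((\<lambda>x. b * S (1 - x)) has_real_derivative - b * C (1 - x)) (at x within {1/2..1})"
        using has_field_derivative_at_within[OF DERIV_cmult[OF DERIV_chain2[OF SC(1) r]]] by simp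
      then show "(U has_real_derivative - b * C (1 - x)) (at x within {1/2..1})"
        by (rule has_field_derivative_transform_within[where d = 1]) (use x U_right in auto)
      have "((\<lambda>x. - b * C (1 - x)) has_real_derivative - b * (- lam * S (1 - x) * - 1)) (at x within {1/2..1})"
        by (rule has_field_derivative_at_within[OF DERIV_cmult[OF DERIV_chain2[OF SC(2) r]]])
      also have "- b * (- lam * S (1 - x) * - 1) = - lam * (b * S (1 - x))"
        by simp
      finally have "((\<lambda>x. - b * C (1 - x)) has_real_derivative - lam * (b * S (1 - x))) (at x within {1/2..1})" .
      then show "((\<lambda>x. - b * C (1 - x)) has_real_derivative - lam * U x) (at x within {1/2..1})"
        using U_right[OF x] by simp
    qed
  qed
  moreover have "\<exists>x\<in>{0..1}. U x \<noteq> 0"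
  proof (rule ccontr)
    assume "\<not> (\<exists>x\<in>{0..1}. U x \<noteq> 0)"
    \<comment> \<open>If \<open>U\<close> vanishes, so does \<open>S\<close> on the left half and
      with it \<open>C\<close> at 1/4, which contradicts the invariant.\<close>
    then have S0: "S x = 0" if "x \<in> {0<..<1/2}" for x
      using U_left[of x] that by force
    have "((\<lambda>x. 0) has_real_derivative C (1/4)) (at (1/4))"
      by (rule has_field_derivative_transform_within_open[OF SC(1), where S = "{0<..<1/2}"]) (use S0 in auto)
    then have "C (1/4) = 0"
      using DERIV_unique[OF _ DERIV_const] by blast
    then show False
      using fundamental_solution_invariant[OF SC, of "1/4"] S0[of "1/4"] by simp
  qed
  ultimately show "is_eigenvalue lam"
    unfolding is_eigenvalue_def by blast
qed

section \<open>Zero, negative and positive parameters\<close>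

lemma zero_not_eigenvalue: "\<not> is_eigenvalue 0"
proof -
  have "is_eigenvalue 0 \<longleftrightarrow> (1/2 :: real) * (1 - 4 * (1/2)) = 0"
    by (rule is_eigenvalue_iff[where S = "\<lambda>x. x" and C = "\<lambda>_. 1"]) (auto intro!: derivative_eq_intros)
  then show ?thesis by simp
qed

text \<open>The scaling by 2 makes the argument at the midpoint equal to \<open>t\<close>. As sinh t
  is nonzero for t > 0, only the second factor of the characteristic equation remains.\<close>

lemma negative_eigenvalue_iff:
  assumes "t > 0"
  shows "is_eigenvalue (- (2 * t)\<^sup>2) \<longleftrightarrow> t * cosh t = 2 * sinh t"
proof -
  define k where "k = 2 * t"
  have k: "k > 0" using assms by (simp add: k_def)
  have "is_eigenvalue (- k\<^sup>2) \<longleftrightarrow> sinh (k * (1/2)) / k * (cosh (k * (1/2)) - 4 * (sinh (k * (1/2)) / k)) = 0"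
    by (rule is_eigenvalue_iff[where S = "\<lambda>x. sinh (k * x) / k" and C = "\<lambda>x. cosh (k * x)"])
      (use k in \<open>auto intro!: derivative_eq_intros simp: power2_eq_square\<close>)
  also have "\<dots> \<longleftrightarrow> t * cosh t = 2 * sinh t"
    using assms by (auto simp: k_def field_simps)
  finally show ?thesis by (simp add: k_def)
qed

text \<open>Here both factors can vanish: sin t = 0 is the odd family, t cos t = 2 sin t the even
  one. The right-hand side is the characteristic expression times 2 t^2, which makes it entire in
  \<open>t\<close>.\<close>

lemma positive_eigenvalue_iff:
  assumes "t > 0"
  shows "is_eigenvalue ((2 * t)\<^sup>2) \<longleftrightarrow> sin t * (t * cos t - 2 * sin t) = 0"
proof -
  define k where "k = 2 * t"
  have k: "k > 0" using assms by (simp add: k_def)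
  have "is_eigenvalue (k\<^sup>2) \<longleftrightarrow> sin (k * (1/2)) / k * (cos (k * (1/2)) - 4 * (sin (k * (1/2)) / k)) = 0"
    by (rule is_eigenvalue_iff[where S = "\<lambda>x. sin (k * x) / k" and C = "\<lambda>x. cos (k * x)"])
      (use k in \<open>auto intro!: derivative_eq_intros simp: power2_eq_square\<close>)
  also have "\<dots> \<longleftrightarrow> sin t * (t * cos t - 2 * sin t) = 0"
    using assms by (auto simp: k_def field_simps)
  finally show ?thesis by (simp add: k_def)
qed

text \<open>For f t = t cosh t - 2 sinh t one has f 0 = 0, so two positive zeros would by Rolle give
  two positive critical points, and then a positive zero of the second derivative t cosh t, which is
  impossible. Existence comes from a sign change between 1 and 2.\<close>

lemma tanh_eq_half_ex1: "\<exists>!t::real. t > 0 \<and> t * cosh t = 2 * sinh t"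
proof -
  define f where "f t = t * cosh t - 2 * sinh t" for t :: real
  have f': "(f has_real_derivative (t * sinh t - cosh t)) (at t)" for t
    unfolding f_def[abs_def] by (auto intro!: derivative_eq_intros)
  have f'': "((\<lambda>t. t * sinh t - cosh t) has_real_derivative t * cosh t) (at t)" for t :: real
    by (auto intro!: derivative_eq_intros)
  have crit: "\<exists>z. a < z \<and> z < b \<and> z * sinh z - cosh z = 0" if ab: "a < b" "f a = 0" "f b = 0" for a b
  proof -
    obtain z where "a < z" "z < b" "f b - f a = (b - a) * (z * sinh z - cosh z)"
      using MVT2[of a b f "\<lambda>t. t * sinh t - cosh t", OF ab(1) f'] by (elim exE conjE)
    with ab have "z * sinh z - cosh z = 0" by simp
    with \<open>a < z\<close> \<open>z < b\<close> show ?thesis by (intro exI conjI)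
  qed
  have no_two: False if st: "0 < s" "s < t" "f s = 0" "f t = 0" for s t :: real
  proof -
    have "f 0 = 0" by (simp add: f_def)
    obtain u where u: "0 < u" "u < s" "u * sinh u - cosh u = 0"
      using crit[OF st(1) \<open>f 0 = 0\<close> st(3)] by (elim exE conjE)
    obtain v where v: "s < v" "v < t" "v * sinh v - cosh v = 0"
      using crit[OF st(2-4)] by (elim exE conjE)
    have "u < v" using u v by simp
    then obtain z where z: "u < z" "z < v"
      "v * sinh v - cosh v - (u * sinh u - cosh u) = (v - u) * (z * cosh z)"
      using MVT2[of u v "\<lambda>t. t * sinh t - cosh t" "\<lambda>t. t * cosh t", OF \<open>u < v\<close> f''] by (elim exE conjE)
    then have "(v - u) * (z * cosh z) = 0" using u(3) v(3) by simp
    moreover have "0 < z" using u(1) z(1) by (rule less_trans)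
    then have "0 < (v - u) * (z * cosh z)"
      using \<open>u < v\<close> by (intro mult_pos_pos) simp_all
    ultimately show False by (simp only: less_irrefl)
  qed
  have "f 1 < 0"
  proof -
    \<comment> \<open>f 1 equals (3 / e - e) / 2, so e^2 \<ge> 4 suffices.\<close>
    have "(2::real) \<le> exp 1" using exp_ge_add_one_self[of 1] by simp
    then have "(2::real) * 2 \<le> exp 1 * exp 1" by (intro mult_mono) auto
    then show ?thesis
      by (simp add: f_def cosh_def sinh_def exp_minus field_simps)
  qed
  \<comment> \<open>f 2 equals 2 exp (-2).\<close>
  moreover have "f 2 > 0"
    by (simp add: f_def cosh_def sinh_def)
  moreover have "continuous_on {1..2} f"
    by (rule DERIV_continuous_on[OF has_field_derivative_at_within[OF f']])
  ultimately have "\<exists>t\<ge>1. t \<le> 2 \<and> f t = 0"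
    by (intro IVT') simp_all
  then obtain t where "1 \<le> t" "t \<le> 2" "f t = 0"
    by (elim exE conjE)
  then show ?thesis
  proof (intro ex1I[of _ t])
    fix s :: real assume s: "s > 0 \<and> s * cosh s = 2 * sinh s"
    then have "f s = 0" by (simp add: f_def)
    then have "\<not> s < t" "\<not> t < s"
      using no_two[of s t] no_two[of t s] s \<open>1 \<le> t\<close> \<open>f t = 0\<close> by auto
    then show "s = t" by simp
  qed (simp add: f_def)
qed

lemma ex1_negative_eigenvalue: "\<exists>!lam. lam < 0 \<and> is_eigenvalue lam"
proof -
  define t where "t = (THE t::real. t > 0 \<and> t * cosh t = 2 * sinh t)"
  have t: "t > 0" "t * cosh t = 2 * sinh t"
    using theI'[OF tanh_eq_half_ex1] by (simp_all only: t_def)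
  have unique: "s = t" if "s > 0" "s * cosh s = 2 * sinh s" for s
    unfolding t_def using the1_equality[OF tanh_eq_half_ex1 conjI[OF that]] by (rule sym)
  show ?thesis
  proof (rule ex1I[of _ "- (2 * t)\<^sup>2"])
    show "- (2 * t)\<^sup>2 < 0 \<and> is_eigenvalue (- (2 * t)\<^sup>2)"
      using t negative_eigenvalue_iff[OF t(1)] by simp
    fix lam :: real assume lam: "lam < 0 \<and> is_eigenvalue lam"
    define s where "s = sqrt (- lam) / 2"
    have s: "s > 0" "lam = - (2 * s)\<^sup>2"
      using lam by (simp_all add: s_def)
    have "is_eigenvalue (- (2 * s)\<^sup>2)"
      using lam unfolding s(2)[symmetric] by (rule conjunct2)
    then have "s = t"
      by (intro unique s(1)) (simp only: negative_eigenvalue_iff[OF s(1)])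
    then show "lam = - (2 * t)\<^sup>2" by (simp only: s(2))
  qed
qed

text \<open>Eigenvalues in (0, M] give zeros t = sqrt lam / 2 of the nonconstant entire function
  \<open>F\<close> in a compact disc, and there are only finitely many of those.\<close>

lemma finite_eigenvalues_le: "finite {lam. 0 < lam \<and> is_eigenvalue lam \<and> lam \<le> M}"
proof -
  define F :: "complex \<Rightarrow> complex" where "F z = sin z * (z * cos z - 2 * sin z)" for z
  define K :: "complex set" where "K = cball 0 (sqrt M / 2)"
  have "\<not> F constant_on UNIV"
  proof
    assume "F constant_on UNIV"
    \<comment> \<open>Impossible, because the left side is -2 and the right side is 0.\<close>
    then have "F (of_real (pi/2)) = F 0"
      unfolding constant_on_def by (metis UNIV_I)
    moreover have "sin (complex_of_real (pi/2)) = 1" "cos (complex_of_real (pi/2)) = 0"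
      unfolding sin_of_real cos_of_real by simp_all
    ultimately show False by (simp add: F_def)
  qed
  moreover have "F holomorphic_on UNIV"
    unfolding F_def[abs_def] by (intro holomorphic_intros)
  moreover have "compact K" by (simp add: K_def)
  ultimately have "finite {z\<in>K. F z = 0}"
    by (intro holomorphic_compact_finite_zeros[of F UNIV]) (simp_all add: connected_UNIV)
  moreover have "{lam. 0 < lam \<and> is_eigenvalue lam \<and> lam \<le> M} \<subseteq> (\<lambda>z. (2 * Re z)\<^sup>2) ` {z\<in>K. F z = 0}"
  proof
    fix lam assume "lam \<in> {lam. 0 < lam \<and> is_eigenvalue lam \<and> lam \<le> M}"
    then have lam: "0 < lam" "is_eigenvalue lam" "lam \<le> M" by auto
    define t where "t = sqrt lam / 2"
    have t: "t > 0" "lam = (2 * t)\<^sup>2" using lam by (simp_all add: t_def)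
    have "sin t * (t * cos t - 2 * sin t) = 0"
      using lam(2) unfolding t(2) positive_eigenvalue_iff[OF t(1)] .
    moreover have "F (of_real t) = of_real (sin t * (t * cos t - 2 * sin t))"
      unfolding F_def sin_of_real cos_of_real by simp
    ultimately have "F (of_real t) = 0" by (simp only: of_real_0)
    moreover have "complex_of_real t \<in> K"
      using lam by (simp add: K_def t_def)
    ultimately show "lam \<in> (\<lambda>z. (2 * Re z)\<^sup>2) ` {z\<in>K. F z = 0}"
      by (intro image_eqI[of _ _ "of_real t"]) (simp_all add: t(2))
  qed
  ultimately show ?thesis by (rule finite_surj)
qed

text \<open>The positive zeros t = n pi of the sine factor suffice; \<open>Suc n\<close> leaves out
  t = 0. The function sin (2 n pi x) is an eigenfunction: it vanishes at 1/2 and so does not feel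
  the point interaction.\<close>

lemma infinite_positive_eigenvalues: "infinite {lam. 0 < lam \<and> is_eigenvalue lam}"
proof -
  have "inj (\<lambda>n::nat. (2 * (real (Suc n) * pi))\<^sup>2)"
    by (intro injI) (auto simp: power2_eq_iff_nonneg)
  moreover have "range (\<lambda>n::nat. (2 * (real (Suc n) * pi))\<^sup>2) \<subseteq> {lam. 0 < lam \<and> is_eigenvalue lam}"
  proof
    fix lam assume "lam \<in> range (\<lambda>n::nat. (2 * (real (Suc n) * pi))\<^sup>2)"
    then obtain n :: nat where n: "lam = (2 * (real (Suc n) * pi))\<^sup>2" by blast
    have "0 < real (Suc n) * pi" by simp
    moreover have "sin (real (Suc n) * pi) = 0" by (rule sin_npi)
    ultimately show "lam \<in> {lam. 0 < lam \<and> is_eigenvalue lam}"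
      unfolding n using positive_eigenvalue_iff[of "real (Suc n) * pi"] by simp
  qed
  ultimately show ?thesis
    using finite_imageD finite_subset infinite_UNIV_nat by (metis (no_types, lifting))
qed

text \<open>Counting the elements below a point, a finite number by assumption, embeds
  \<open>A\<close> into the naturals and preserves the order. \<open>enumerate\<close> lists the
  image increasingly, and inverting the embedding gives \<mu>.\<close>

lemma mono_enumeration_real:
  fixes A :: "real set"
  assumes inf: "infinite A" and fin: "\<And>M. finite {x\<in>A. x \<le> M}"
  obtains \<mu> :: "nat \<Rightarrow> real" where "mono \<mu>" "range \<mu> = A"
proof -
  define r where "r x = card {y\<in>A. y < x}" for x
  have less: "r x < r y" if "x \<in> A" "x < y" for x y
    unfolding r_def
  proof (rule psubset_card_mono)
    show "finite {z\<in>A. z < y}"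
      by (rule finite_subset[OF _ fin[of y]]) auto
    show "{z\<in>A. z < x} \<subset> {z\<in>A. z < y}"
      using that by auto
  qed
  have inj: "inj_on r A"
    by (rule linorder_inj_onI') (use less in force)
  then have infR: "infinite (r ` A)"
    using inf finite_image_iff by blast
  define e where "e = enumerate (r ` A)"
  have e: "range e = r ` A" "strict_mono e"
    unfolding e_def using infR range_enumerate strict_mono_enumerate by blast+
  define \<mu> where "\<mu> n = the_inv_into A r (e n)" for n
  have \<mu>: "\<mu> n \<in> A" "r (\<mu> n) = e n" for n
  proof -
    have "e n \<in> r ` A" using e(1) by blast
    then show "\<mu> n \<in> A" "r (\<mu> n) = e n"
      unfolding \<mu>_def by (rule the_inv_into_into[OF inj _ subset_refl], rule f_the_inv_into_f[OF inj])
  qed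
  have "mono \<mu>"
  proof (rule monoI, rule ccontr)
    fix m n :: nat assume "m \<le> n" "\<not> \<mu> m \<le> \<mu> n"
    then have "e n < e m" using less[OF \<mu>(1)[of n], of "\<mu> m"] \<mu>(2) by simp
    moreover have "e m \<le> e n" using e(2) \<open>m \<le> n\<close> by (simp add: strict_mono_less_eq)
    ultimately show False by simp
  qed
  moreover have "range \<mu> = A"
  proof
    show "range \<mu> \<subseteq> A" using \<mu>(1) by blast
    show "A \<subseteq> range \<mu>"
    proof
      fix x assume x: "x \<in> A"
      then obtain n where "e n = r x" using e(1) by (metis imageE image_eqI)
      then have "\<mu> n = x" using the_inv_into_f_f[OF inj x] by (simp add: \<mu>_def)
      then show "x \<in> range \<mu>" by blast
    qed
  qed
  ultimately show thesis by (rule that)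
qed

theorem proposition4:
  shows "(\<exists>!lam\<^sub>1. lam\<^sub>1 < 0 \<and> is_eigenvalue lam\<^sub>1) \<and>
    \<not> is_eigenvalue 0 \<and>
    infinite {lam. 0 < lam \<and> is_eigenvalue lam} \<and>
    countable {lam. 0 < lam \<and> is_eigenvalue lam} \<and>
    (\<exists>\<mu> :: nat \<Rightarrow> real. mono \<mu> \<and> range \<mu> = {lam. 0 < lam \<and> is_eigenvalue lam})"
proof -
  have "finite {x \<in> {lam. 0 < lam \<and> is_eigenvalue lam}. x \<le> M}" for M
    using finite_eigenvalues_le[of M] by (simp add: conj_assoc)
  with infinite_positive_eigenvalues
  obtain \<mu> :: "nat \<Rightarrow> real" where \<mu>: "mono \<mu>" "range \<mu> = {lam. 0 < lam \<and> is_eigenvalue lam}"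
    by (rule mono_enumeration_real)
  moreover have "countable (range \<mu>)" by simp
  ultimately show ?thesis
    by (intro conjI exI[of _ \<mu>] ex1_negative_eigenvalue zero_not_eigenvalue infinite_positive_eigenvalues) simp_all
qed

end
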